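(* Let $F\in\mathbb{F}$ and let $A$ be a three-option data matrix on the objects $1,\dots,n$. Consider the following set of three conditions on $A$. (A-NS) There is at least one index pair $(i,j)$ for which $0<A_{i,j,2}$. (B-NS) For any partition of $\{1,2,\dots,n\}$ into two non-empty sets $S$ and $\overline{S}$ (so $S\cup\overline{S}=\{1,\dots,n\}$, $S\cap\overline{S}=\emptyset$), either there are $i\in S$ and $j\in\overline{S}$ for which $0<A_{i,j,2}$, or there are two (not necessarily different) pairs $(i_1,j_1)$ and $(i_2,j_2)$ with $i_1,i_2\in S$, $j_1,j_2\in\overline{S}$, for which $0<A_{i_1,j_1,3}$ and $0<A_{i_2,j_2,1}$. (C-NS) There exists a directed cycle in the graph $GR_{dir}^{(3)}$ of $A$ in which the number of directed 'better' edges exceeds the number of bi-directional 'equal' edges. Then: (1) (model THMM3) The log-likelihood function $\log L_{F}(A\mid m_1,\dots,m_n,d)$ attains a maximal value on $\{(m_1,\dots,m_n,d)\in\mathbb{R}^{n+1}: m_1=0,\ 0<d\}$ and the argument of the maximum is unique if and only if A-NS, B-NS and C-NS all hold. (2) (model D3) The log-likelihood function $\log L_{D}(A\mid \pi_1,\dots,\pi_n,\nu)$ attains a maximal value on $\{(\pi_1,\dots,\pi_n,\nu)\in\mathbb{R}^{n+1}: 0<\pi_i\ (i=1,\dots,n),\ \sum_{i=1}^n\pi_i=1,\ 0<\nu\}$ and the argument of the maximum is unique if and only if A-NS, B-NS and C-NS all hold.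
   Context: Class $\mathbb{F}$: the set of cumulative distribution functions $F:\mathbb{R}\to\mathbb{R}$ that are three times continuously differentiable, satisfy $0<F<1$, and whose density $f=F'$ satisfies $f>0$, $f(-x)=f(x)$ for all $x\in\mathbb{R}$, and $\log f$ is strictly concave. Data matrix: a three-option data matrix $A$ on objects $1,\dots,n$ consists of non-negative integers $A_{i,j,k}$ ($i\ne j$ in $\{1,\dots,n\}$, $k\in\{1,2,3\}$), where $A_{i,j,1}$, $A_{i,j,2}$, $A_{i,j,3}$ are the numbers of comparisons of $i$ and $j$ in which $i$ was judged 'worse' than, 'equal' to, 'better' than $j$, respectively. Thus $A_{i,j,1}=A_{j,i,3}$ and $A_{i,j,2}=A_{j,i,2}$. THMM3 (three-option Thurstone motivated model): for $m_1,\dots,m_n\in\mathbb{R}$ and $d>0$ put $p_{i,j,1}=F(-d-(m_i-m_j))$, $p_{i,j,2}=F(d-(m_i-m_j))-F(-d-(m_i-m_j))$, $p_{i,j,3}=1-F(d-(m_i-m_j))$, and $$\log L_F(A\mid m_1,\dots,m_n,d)=\sum_{k=1}^{3}\sum_{i=1}^{n-1}\sum_{j=i+1}^{n}A_{i,j,k}\log p_{i,j,k}.$$ D3 (Davidson's model): for $\pi_1,\dots,\pi_n>0$ and $\nu>0$ put $p_{i,j,1}=\frac{\pi_j}{\pi_i+\pi_j+\nu\sqrt{\pi_i\pi_j}}$, $p_{i,j,2}=\frac{\nu\sqrt{\pi_i\pi_j}}{\pi_i+\pi_j+\nu\sqrt{\pi_i\pi_j}}$, $p_{i,j,3}=\frac{\pi_i}{\pi_i+\pi_j+\nu\sqrt{\pi_i\pi_j}}$,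 and $$\log L_D(A\mid \pi_1,\dots,\pi_n,\nu)=\sum_{k=1}^{3}\sum_{i=1}^{n-1}\sum_{j=i+1}^{n}A_{i,j,k}\log p_{i,j,k}.$$ Graph $GR_{dir}^{(3)}$ of $A$: its nodes are $1,\dots,n$; there is a directed 'better' edge $i\to j$ if $A_{i,j,3}>0$, and a bi-directional 'equal' edge $i\longleftrightarrow j$ if $A_{i,j,2}>0$ (both kinds may be present between the same two nodes). A directed cycle is a sequence of nodes $(i_1,i_2,\dots,i_l,i_1)$ in which any two consecutive nodes are connected either by a directed 'better' edge $i_k\to i_{k+1}$ (traversed in its direction) or by a bi-directional 'equal' edge $i_k\longleftrightarrow i_{k+1}$; for each step one such edge is used, and edges are counted by the steps of the cycle. *)

theory Defs
  imports "HOL-Probability.Probability"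
begin

definition strictly_concave :: "(real \<Rightarrow> real) \<Rightarrow> bool" where
  "strictly_concave g \<longleftrightarrow>
     (\<forall>x y t. x \<noteq> y \<longrightarrow> 0 < t \<longrightarrow> t < 1 \<longrightarrow>
        (1 - t) * g x + t * g y < g ((1 - t) * x + t * y))"

definition C3 :: "(real \<Rightarrow> real) \<Rightarrow> bool" where
  "C3 F \<longleftrightarrow>
     (\<forall>k<3. \<forall>x. (deriv ^^ k) F differentiable (at x)) \<and>
     continuous_on UNIV ((deriv ^^ 3) F)"

definition class_F :: "(real \<Rightarrow> real) set" where
  "class_F = {F.
     (\<exists>M. real_distribution M \<and> F = cdf M) \<and>
     C3 F \<and>
     (\<forall>x. 0 < F x \<and> F x < 1) \<and>
     (\<forall>x. 0 < deriv F x) \<and>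
     (\<forall>x. deriv F (- x) = deriv F x) \<and>
     strictly_concave (\<lambda>x. ln (deriv F x))}"

text \<open>
  The objects are \<open>1, \<dots>, n\<close>. In \<open>A i j k\<close> the option \<open>k\<close> is 1 for `\<open>i\<close> worse than \<open>j\<close>',
  2 for `equal' and 3 for `\<open>i\<close> better than \<open>j\<close>'. Values of \<open>A\<close> for \<open>i = j\<close>, for indices
  outside \<open>{1..n}\<close> or for options outside \<open>{1..3}\<close> are unconstrained and never used.
\<close>

definition data_matrix :: "nat \<Rightarrow> (nat \<Rightarrow> nat \<Rightarrow> nat \<Rightarrow> nat) \<Rightarrow> bool" where
  "data_matrix n A \<longleftrightarrow>
     (\<forall>i\<in>{1..n}. \<forall>j\<in>{1..n}. i \<noteq> j \<longrightarrow> A i j 1 = A j i 3 \<and> A i j 2 = A j i 2)"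

definition log_likelihood ::
  "nat \<Rightarrow> (nat \<Rightarrow> nat \<Rightarrow> nat \<Rightarrow> nat) \<Rightarrow> (nat \<Rightarrow> nat \<Rightarrow> nat \<Rightarrow> real) \<Rightarrow> real" where
  "log_likelihood n A p =
     (\<Sum>k=1..3. \<Sum>i=1..n-1. \<Sum>j=i+1..n. real (A i j k) * ln (p i j k))"

definition prob_THMM3 ::
  "(real \<Rightarrow> real) \<Rightarrow> (nat \<Rightarrow> real) \<Rightarrow> real \<Rightarrow> nat \<Rightarrow> nat \<Rightarrow> nat \<Rightarrow> real" where
  "prob_THMM3 F m d i j k =
     (if k = 1 then F (- d - (m i - m j))
      else if k = 2 then F (d - (m i - m j)) - F (- d - (m i - m j))
      else 1 - F (d - (m i - m j)))"

definition prob_D3 :: "(nat \<Rightarrow> real) \<Rightarrow> real \<Rightarrow> nat \<Rightarrow> nat \<Rightarrow> nat \<Rightarrow> real" where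
  "prob_D3 \<pi> \<nu> i j k =
     (if k = 1 then \<pi> j / (\<pi> i + \<pi> j + \<nu> * sqrt (\<pi> i * \<pi> j))
      else if k = 2 then \<nu> * sqrt (\<pi> i * \<pi> j) / (\<pi> i + \<pi> j + \<nu> * sqrt (\<pi> i * \<pi> j))
      else \<pi> i / (\<pi> i + \<pi> j + \<nu> * sqrt (\<pi> i * \<pi> j)))"

definition loglik_THMM3 ::
  "(real \<Rightarrow> real) \<Rightarrow> nat \<Rightarrow> (nat \<Rightarrow> nat \<Rightarrow> nat \<Rightarrow> nat) \<Rightarrow> (nat \<Rightarrow> real) \<times> real \<Rightarrow> real" where
  "loglik_THMM3 F n A = (\<lambda>(m, d). log_likelihood n A (prob_THMM3 F m d))"

definition loglik_D3 ::
  "nat \<Rightarrow> (nat \<Rightarrow> nat \<Rightarrow> nat \<Rightarrow> nat) \<Rightarrow> (nat \<Rightarrow> real) \<times> real \<Rightarrow> real" where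
  "loglik_D3 n A = (\<lambda>(\<pi>, \<nu>). log_likelihood n A (prob_D3 \<pi> \<nu>))"

text \<open>
  Vectors in \<open>\<real>\<^sup>n\<close> are functions that are \<open>undefined\<close> outside \<open>{1..n}\<close>, so that two parameter
  vectors are equal iff their components \<open>1, \<dots>, n\<close> agree; uniqueness of the maximizer relies on this.
\<close>

definition params_THMM3 :: "nat \<Rightarrow> ((nat \<Rightarrow> real) \<times> real) set" where
  "params_THMM3 n = {(m, d). m \<in> {1..n} \<rightarrow>\<^sub>E UNIV \<and> m 1 = 0 \<and> 0 < d}"

definition params_D3 :: "nat \<Rightarrow> ((nat \<Rightarrow> real) \<times> real) set" where
  "params_D3 n = {(\<pi>, \<nu>). \<pi> \<in> {1..n} \<rightarrow>\<^sub>E UNIV \<and> (\<forall>i\<in>{1..n}. 0 < \<pi> i) \<and>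
     (\<Sum>i=1..n. \<pi> i) = 1 \<and> 0 < \<nu>}"

definition A_NS :: "nat \<Rightarrow> (nat \<Rightarrow> nat \<Rightarrow> nat \<Rightarrow> nat) \<Rightarrow> bool" where
  "A_NS n A \<longleftrightarrow> (\<exists>i\<in>{1..n}. \<exists>j\<in>{1..n}. i \<noteq> j \<and> 0 < A i j 2)"

definition B_NS :: "nat \<Rightarrow> (nat \<Rightarrow> nat \<Rightarrow> nat \<Rightarrow> nat) \<Rightarrow> bool" where
  "B_NS n A \<longleftrightarrow>
     (\<forall>S T. S \<union> T = {1..n} \<and> S \<inter> T = {} \<and> S \<noteq> {} \<and> T \<noteq> {} \<longrightarrow>
        (\<exists>i\<in>S. \<exists>j\<in>T. 0 < A i j 2) \<or>
        (\<exists>i\<^sub>1\<in>S. \<exists>j\<^sub>1\<in>T. \<exists>i\<^sub>2\<in>S. \<exists>j\<^sub>2\<in>T. 0 < A i\<^sub>1 j\<^sub>1 3 \<and> 0 < A i\<^sub>2 j\<^sub>2 1))"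

datatype edge_kind = Better | Equal

fun GR_edge :: "nat \<Rightarrow> (nat \<Rightarrow> nat \<Rightarrow> nat \<Rightarrow> nat) \<Rightarrow> edge_kind \<Rightarrow> nat \<Rightarrow> nat \<Rightarrow> bool" where
  "GR_edge n A Better i j \<longleftrightarrow> i \<in> {1..n} \<and> j \<in> {1..n} \<and> i \<noteq> j \<and> 0 < A i j 3"
| "GR_edge n A Equal i j \<longleftrightarrow> i \<in> {1..n} \<and> j \<in> {1..n} \<and> i \<noteq> j \<and> 0 < A i j 2"

text \<open>
  The cycle \<open>(i\<^sub>1, \<dots>, i\<^sub>l, i\<^sub>1)\<close> is given by the list \<open>vs\<close> of its nodes \<open>i\<^sub>1, \<dots>, i\<^sub>l\<close>, without the
  final repetition of \<open>i\<^sub>1\<close>, together with the list \<open>ks\<close> of the kinds of the edges used in its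
  \<open>l\<close> steps. Nodes may be visited more than once.
\<close>

definition directed_cycle ::
  "nat \<Rightarrow> (nat \<Rightarrow> nat \<Rightarrow> nat \<Rightarrow> nat) \<Rightarrow> nat list \<Rightarrow> edge_kind list \<Rightarrow> bool" where
  "directed_cycle n A vs ks \<longleftrightarrow>
     vs \<noteq> [] \<and> length ks = length vs \<and>
     (\<forall>r<length vs. GR_edge n A (ks ! r) (vs ! r) (vs ! ((r + 1) mod length vs)))"

definition C_NS :: "nat \<Rightarrow> (nat \<Rightarrow> nat \<Rightarrow> nat \<Rightarrow> nat) \<Rightarrow> bool" where
  "C_NS n A \<longleftrightarrow>
     (\<exists>vs ks. directed_cycle n A vs ks \<and> count_list ks Equal < count_list ks Better)"

end

theory Submission
  imports Defs
begin

text \<open>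
  Both models are treated as one. In the coordinates \<open>x = m i - m j\<close> and \<open>d\<close> (with \<open>m i = (ln \<pi>\<^sub>i - ln \<pi>\<^sub>1) / 2\<close> and
  \<open>d = ln \<nu>\<close> for Davidson's model) the log-likelihood is a positively weighted sum, over the edges of the
  comparison graph, of the logarithms of outcome probabilities. These probabilities are monotone in
  suitable directions, decay along others, and are log-concave in \<open>(x, d)\<close>. The locale
  \<open>comparison_model\<close> collects these properties, and its theorem \<open>unique_maximizer_iff\<close> is the claim for
  every such model.

  If one of the three conditions fails, the parameters can be moved without making any
  observation less likely, so a maximizer is never unique. Without ties, \<open>d\<close> is lowered. If some
  set of objects has no edge leaving it, the remaining objects are raised together. If no cycle has more
  `better' than `equal' edges, the difference constraints \<open>v i - v j \<ge> 1\<close> along `better' edges and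
  \<open>v i - v j \<ge> - 1\<close> along `equal' edges have no negative cycle, hence a solution \<open>v\<close>
  (\<open>not_C_NS_potential\<close>), and \<open>(m, d)\<close> is moved by \<open>(v, 1)\<close>.

  If all three hold, superlevel sets are bounded (\<open>superlevel_bounded\<close>): on such a set every edge satisfies
  \<open>m i - m j \<ge> d - c\<close> or \<open>m i - m j \<ge> - d - c\<close>, according to its kind. Summing around a cycle
  with more `better' than `equal' edges bounds \<open>d\<close> from above, a tie bounds it from below, and strong connectedness of the graph bounds \<open>m\<close>. So a
  maximum is attained. It is unique because the inequality of strict concavity between two maximizers
  must be tight on every edge, which by connectedness forces them to coincide (\<open>maximizer_unique\<close>).

  What remains is log-concavity. For Davidson's model it is the Cauchy-Schwarz inequality
  (\<open>exp_trinomial_midpoint\<close>). For the Thurstone model, strict log-concavity of the density passes to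
  \<open>F\<close> and to the increments \<open>F u - F w\<close> by a second-derivative computation based on the monotonicity of
  \<open>f' / f\<close> (\<open>F_curvature\<close> and \<open>F_increment_curvature\<close>).
\<close>

section \<open>Potentials for difference constraints\<close>

text \<open>
  A triple \<open>(i, j, c)\<close> is read both as an edge of cost \<open>c\<close> and as the constraint
  \<open>v j \<le> v i + c\<close> on a potential \<open>v\<close>; adding up the constraints along a walk bounds
  \<open>v j - v i\<close> by the cost of the walk.
\<close>

inductive walk :: "('a \<times> 'a \<times> real) set \<Rightarrow> 'a \<Rightarrow> 'a \<Rightarrow> real \<Rightarrow> bool" for r where
  edge: "(i, j, c) \<in> r \<Longrightarrow> walk r i j c"
| step: "walk r i j a \<Longrightarrow> (j, k, b) \<in> r \<Longrightarrow> walk r i k (a + b)"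

lemma walk_trans:
  assumes "walk r j k b" "walk r i j a"
  shows "walk r i k (a + b)"
  using assms
proof (induction rule: walk.induct)
  case (edge j k b)
  then show ?case by (blast intro: walk.step)
next
  case (step j k b l c)
  from walk.step[OF step.IH[OF step.prems] step.hyps(2)] show ?case
    by (simp add: add.assoc)
qed

lemma separating_real:
  fixes L U :: "real set"
  assumes "finite L" "finite U" "\<And>l u. l \<in> L \<Longrightarrow> u \<in> U \<Longrightarrow> l \<le> u"
  obtains t where "\<And>l. l \<in> L \<Longrightarrow> l \<le> t" "\<And>u. u \<in> U \<Longrightarrow> t \<le> u"
proof (cases "L = {}")
  case True
  show ?thesis
  proof (cases "U = {}")
    case True
    with \<open>L = {}\<close> that show ?thesis by blast
  next
    case False
    with \<open>L = {}\<close> that[of "Min U"] assms(2) show ?thesis by auto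
  qed
next
  case False
  with that[of "Max L"] assms show ?thesis by auto
qed

text \<open>
  A system of difference constraints is solvable if no closed walk has negative cost. The proof
  is Fourier-Motzkin elimination: to remove the vertex \<open>x\<close>, every pair of edges into and out of \<open>x\<close> is
  replaced by the composite edge. Closed walks of the reduced system come from closed walks of the
  original one, so the reduced system has a solution, and the composite edges say exactly that every
  lower bound on the value at \<open>x\<close> is below every upper bound.
\<close>

lemma potential_exists:
  fixes r :: "('a \<times> 'a \<times> real) set"
  assumes "finite V" "finite r" "r \<subseteq> V \<times> V \<times> UNIV"
    and "\<And>i c. walk r i i c \<Longrightarrow> 0 \<le> c"
  shows "\<exists>v :: 'a \<Rightarrow> real. \<forall>(i, j, c)\<in>r. v j \<le> v i + c"
  using assms
proof (induction V arbitrary: r rule: finite_induct)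
  case empty
  then show ?case by auto
next
  case (insert x V)
  \<comment> \<open>the system after elimination of \<open>x\<close>\<close>
  define r' where "r' = {(i, j, c) \<in> r. i \<in> V \<and> j \<in> V} \<union>
    {(i, j, c). i \<in> V \<and> j \<in> V \<and> (\<exists>a b. (i, x, a) \<in> r \<and> (x, j, b) \<in> r \<and> c = a + b)}"
  have "r' \<subseteq> r \<union> (\<lambda>((i, _, a), (_, j, b)). (i, j, a + b)) ` (r \<times> r)"
    unfolding r'_def by force
  then have fin: "finite r'"
    by (rule finite_subset) (use insert.prems(1) in auto)
  have r'_walk: "walk r i j c" if "walk r' i j c" for i j c
    using that
  proof (induction rule: walk.induct)
    case (edge i j c)
    then show ?case by (auto simp: r'_def intro: walk.intros)
  next
    case (step i j a k b)
    from step.hyps(2) have "walk r j k b" by (auto simp: r'_def intro: walk.intros)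
    with step.IH show ?case by (blast intro: walk_trans)
  qed
  have "r' \<subseteq> V \<times> V \<times> UNIV" by (auto simp: r'_def)
  from insert.IH[OF fin this] insert.prems(3) r'_walk
  have "\<exists>v :: 'a \<Rightarrow> real. \<forall>(i, j, c)\<in>r'. v j \<le> v i + c" by blast
  then obtain v :: "'a \<Rightarrow> real" where v: "\<And>i j c. (i, j, c) \<in> r' \<Longrightarrow> v j \<le> v i + c" by fast
  \<comment> \<open>the lower and upper bounds that the eliminated edges impose on the value at \<open>x\<close>\<close>
  define L where "L = (\<lambda>(_, j, b). v j - b) ` {(i, j, b) \<in> r. i = x \<and> j \<in> V}"
  define U where "U = (\<lambda>(i, _, a). v i + a) ` {(i, j, b) \<in> r. i \<in> V \<and> j = x}"
  have "finite {(i, j, b) \<in> r. i = x \<and> j \<in> V}" "finite {(i, j, b) \<in> r. i \<in> V \<and> j = x}"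
    by (rule finite_subset[OF _ insert.prems(1)]; auto)+
  then have LU: "finite L" "finite U" by (auto simp: L_def U_def)
  have "l \<le> u" if lu: "l \<in> L" "u \<in> U" for l u
  proof -
    obtain i j a b where "i \<in> V" "j \<in> V" "(i, x, a) \<in> r" "(x, j, b) \<in> r" "l = v j - b" "u = v i + a"
      using lu by (auto simp: L_def U_def)
    moreover from this have "(i, j, a + b) \<in> r'" by (auto simp: r'_def)
    ultimately show ?thesis using v by fastforce
  qed
  then obtain t where t: "\<And>l. l \<in> L \<Longrightarrow> l \<le> t" "\<And>u. u \<in> U \<Longrightarrow> t \<le> u"
    using separating_real[OF LU] by blast
  have "(v(x := t)) j \<le> (v(x := t)) i + c" if e: "(i, j, c) \<in> r" for i j c
  proof -
    have ij: "i \<in> insert x V" "j \<in> insert x V" using e insert.prems(2) by auto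
    consider "i = x" "j = x" | "i = x" "j \<noteq> x" "j \<in> V" | "i \<noteq> x" "i \<in> V" "j = x"
      | "i \<noteq> x" "j \<noteq> x" "i \<in> V" "j \<in> V" using ij by blast
    then show ?thesis
    proof cases
      case 1
      then show ?thesis using insert.prems(3) e by (auto intro: walk.edge)
    next
      case 2
      then have "v j - c \<in> L" using e by (force simp: L_def)
      then show ?thesis using t(1) 2 by fastforce
    next
      case 3
      then have "v i + c \<in> U" using e by (force simp: U_def)
      then show ?thesis using t(2) 3 by fastforce
    next
      case 4
      then have "(i, j, c) \<in> r'" using e by (auto simp: r'_def)
      then show ?thesis using v 4 by auto
    qed
  qed
  then show ?case by blast
qed

section \<open>The comparison graph\<close>

definition edges :: "nat \<Rightarrow> (nat \<Rightarrow> nat \<Rightarrow> nat \<Rightarrow> nat) \<Rightarrow> (edge_kind \<times> nat \<times> nat) set" where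
  "edges n A = {(k, i, j). GR_edge n A k i j}"

text \<open>
  The rate at which the difference \<open>m i - m j\<close> along an edge is forced to grow with the threshold \<open>d\<close>:
  a `better' observation stays likely only if \<open>m i - m j\<close> keeps up with \<open>d\<close>, an `equal' one only if
  \<open>m i - m j\<close> does not fall behind \<open>- d\<close>. The total gain of a cycle is its number of `better' edges
  minus its number of `equal' edges.
\<close>

fun gain :: "edge_kind \<Rightarrow> real" where
  "gain Better = 1"
| "gain Equal = - 1"

lemma UNIV_edge_kind: "UNIV = {Better, Equal}"
  by (auto intro: edge_kind.exhaust)

lemma GR_edge_verts: "GR_edge n A k i j \<Longrightarrow> i \<in> {1..n} \<and> j \<in> {1..n} \<and> i \<noteq> j"
  by (cases k) auto

lemma finite_edges: "finite (edges n A)"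
proof (rule finite_subset)
  show "edges n A \<subseteq> {Better, Equal} \<times> {1..n} \<times> {1..n}"
    using GR_edge_verts UNIV_edge_kind by (force simp: edges_def)
qed auto

lemma sum_gain: "(\<Sum>r<length ks. gain (ks ! r)) = real (count_list ks Better) - real (count_list ks Equal)"
proof (induction ks)
  case (Cons k ks)
  have "(\<Sum>r<length (k # ks). gain ((k # ks) ! r)) = gain k + (\<Sum>r<length ks. gain (ks ! r))"
    by (simp only: list.size sum.lessThan_Suc_shift nth_Cons_0 nth_Cons_Suc add_Suc_right add_0_right)
  with Cons.IH show ?case by (cases k) auto
qed simp

lemma sum_cyclic_shift:
  fixes h :: "nat \<Rightarrow> real"
  shows "(\<Sum>r<l. h ((r + 1) mod l)) = (\<Sum>r<l. h r)"
proof (cases l)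
  case (Suc k)
  have "(\<Sum>r<Suc k. h ((r + 1) mod Suc k)) = (\<Sum>r<k. h (Suc r)) + h 0" by simp
  also have "\<dots> = (\<Sum>r<Suc k. h r)" by (simp only: sum.lessThan_Suc_shift add.commute)
  finally show ?thesis by (simp add: Suc)
qed simp

text \<open>
  A walk of edge triples is unfolded into the lists of nodes and edge kinds in which directed cycles
  are expressed; the end node \<open>j\<close> is kept apart from the list, so that for \<open>i = j\<close> it is the omitted
  repetition of the first node.
\<close>

lemma walk_to_lists:
  assumes "walk {(i, j, c). \<exists>k. (k, i, j) \<in> edges n A \<and> c = - gain k} i j c"
  shows "\<exists>vs ks. vs \<noteq> [] \<and> length ks = length vs \<and> vs ! 0 = i \<and>
    (\<forall>r<length vs. GR_edge n A (ks ! r) (vs ! r) ((vs @ [j]) ! (r + 1))) \<and>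
    c = - (\<Sum>r<length ks. gain (ks ! r))"
  using assms
proof (induction rule: walk.induct)
  case (edge i j c)
  then obtain k where "GR_edge n A k i j" "c = - gain k" by (auto simp: edges_def)
  then show ?case by (intro exI[of _ "[i]"] exI[of _ "[k]"]) auto
next
  case (step i j a l b)
  obtain k where k: "GR_edge n A k j l" "b = - gain k" using step.hyps(2) by (auto simp: edges_def)
  obtain vs ks where vs: "vs \<noteq> []" "length ks = length vs" "vs ! 0 = i"
    "\<And>r. r < length vs \<Longrightarrow> GR_edge n A (ks ! r) (vs ! r) ((vs @ [j]) ! (r + 1))"
    "a = - (\<Sum>r<length ks. gain (ks ! r))" using step.IH by blast
  have "GR_edge n A ((ks @ [k]) ! r) ((vs @ [j]) ! r) (((vs @ [j]) @ [l]) ! (r + 1))"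
    if "r < length (vs @ [j])" for r
  proof (cases "r < length vs")
    case True
    then show ?thesis using vs(4)[OF True] vs(2) by (auto simp: nth_append)
  next
    case False
    with that have "r = length vs" by simp
    then show ?thesis using k vs(2) by (simp add: nth_append)
  qed
  then show ?case using vs(1,2,3,5) k(2)
    by (intro exI[of _ "vs @ [j]"] exI[of _ "ks @ [k]"]) (auto simp: nth_append)
qed

text \<open>
  With edge costs \<open>- gain\<close>, a closed walk of negative cost is a cycle with more `better' than `equal'
  edges, so without such a cycle a potential exists. It is the direction in which the parameters can
  be moved to infinity without making any observation less likely.
\<close>

lemma not_C_NS_potential:
  assumes "\<not> C_NS n A"
  shows "\<exists>v :: nat \<Rightarrow> real. \<forall>(k, i, j)\<in>edges n A. gain k \<le> v i - v j"
proof -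
  define r where "r = {(i, j, c). \<exists>k. (k, i, j) \<in> edges n A \<and> c = - gain k}"
  have "r = (\<lambda>(k, i, j). (i, j, - gain k)) ` edges n A" by (force simp: r_def)
  then have fin: "finite r" using finite_edges by simp
  have sub: "r \<subseteq> {1..n} \<times> {1..n} \<times> UNIV"
    using GR_edge_verts by (fastforce simp: r_def edges_def)
  have "0 \<le> c" if w: "walk r i i c" for i c
  proof -
    obtain vs ks where vs: "vs \<noteq> []" "length ks = length vs" "vs ! 0 = i"
      "\<And>r. r < length vs \<Longrightarrow> GR_edge n A (ks ! r) (vs ! r) ((vs @ [i]) ! (r + 1))"
      "c = - (\<Sum>r<length ks. gain (ks ! r))"
      using walk_to_lists[OF w[unfolded r_def]] by blast
    have "(vs @ [i]) ! (r + 1) = vs ! ((r + 1) mod length vs)" if "r < length vs" for r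
    proof (cases "r + 1 = length vs")
      case True
      then have "(vs @ [i]) ! (r + 1) = i" by (metis nth_append_length)
      with True vs(3) show ?thesis by simp
    next
      case False
      with that have "r + 1 < length vs" by simp
      then show ?thesis by (simp add: nth_append)
    qed
    with vs have "directed_cycle n A vs ks" unfolding directed_cycle_def by metis
    with assms have "count_list ks Better \<le> count_list ks Equal"
      unfolding C_NS_def by (meson not_le)
    with vs(5) show ?thesis by (simp add: sum_gain)
  qed
  from potential_exists[OF _ fin sub this] obtain v :: "nat \<Rightarrow> real"
    where v: "\<And>i j c. (i, j, c) \<in> r \<Longrightarrow> v j \<le> v i + c" by fastforce
  have "gain k \<le> v i - v j" if "(k, i, j) \<in> edges n A" for k i j
    using v[of i j "- gain k"] that unfolding r_def by fastforce
  then show ?thesis by blast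
qed

text \<open>
  The differences \<open>m i - m j\<close> telescope to \<open>0\<close> around a cycle, so summing the lower bounds around a
  cycle of positive total gain \<open>g\<close> bounds the threshold from above.
\<close>

lemma C_NS_bounds:
  assumes "C_NS n A"
  obtains l :: real and g :: real where "0 < g"
    "\<And>(m :: nat \<Rightarrow> real) d c. (\<And>k i j. (k, i, j) \<in> edges n A \<Longrightarrow> gain k * d - c \<le> m i - m j) \<Longrightarrow> g * d \<le> l * c"
proof -
  obtain vs ks where cyc: "directed_cycle n A vs ks" and cnt: "count_list ks Equal < count_list ks Better"
    using assms by (auto simp: C_NS_def)
  have len: "length ks = length vs" using cyc by (simp add: directed_cycle_def)
  let ?g = "real (count_list ks Better) - real (count_list ks Equal)"
  have bound: "?g * d \<le> real (length vs) * c"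
    if b: "\<And>k i j. (k, i, j) \<in> edges n A \<Longrightarrow> gain k * d - c \<le> m i - m j" for m :: "nat \<Rightarrow> real" and d c
  proof -
    have "?g * d - real (length vs) * c = (\<Sum>r<length vs. gain (ks ! r) * d - c)"
      by (simp add: sum_subtractf sum_distrib_right[symmetric] sum_gain len[symmetric])
    also have "\<dots> \<le> (\<Sum>r<length vs. m (vs ! r) - m (vs ! ((r + 1) mod length vs)))"
      by (intro sum_mono b) (use cyc in \<open>auto simp: directed_cycle_def edges_def\<close>)
    also have "\<dots> = 0"
      using sum_cyclic_shift[of "\<lambda>r. m (vs ! r)" "length vs"] by (simp add: sum_subtractf)
    finally show ?thesis by simp
  qed
  show thesis
  proof (rule that)
    show "0 < ?g" using cnt by simp
  qed (rule bound)
qed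

lemma Equal_edge_sym:
  assumes "data_matrix n A" "(Equal, i, j) \<in> edges n A"
  shows "(Equal, j, i) \<in> edges n A"
  using assms by (auto simp: edges_def data_matrix_def)

text \<open>
  Applied to a cut and to its complement, the existence of a leaving edge gives edges in both
  directions; either one of them is an `equal' edge or both are `better' edges.
\<close>

lemma B_NS_iff_cuts:
  assumes "data_matrix n A"
  shows "B_NS n A \<longleftrightarrow> (\<forall>S. S \<subseteq> {1..n} \<and> S \<noteq> {} \<and> S \<noteq> {1..n} \<longrightarrow>
    (\<exists>k i j. (k, i, j) \<in> edges n A \<and> i \<in> S \<and> j \<notin> S))" (is "_ \<longleftrightarrow> ?cuts")
proof
  assume B: "B_NS n A"
  show ?cuts
  proof (intro allI impI)
    fix S assume S: "S \<subseteq> {1..n} \<and> S \<noteq> {} \<and> S \<noteq> {1..n}"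
    then have "S \<union> ({1..n} - S) = {1..n} \<and> S \<inter> ({1..n} - S) = {} \<and> S \<noteq> {} \<and> {1..n} - S \<noteq> {}"
      by blast
    with B consider (eq) "\<exists>i\<in>S. \<exists>j\<in>{1..n} - S. 0 < A i j 2" | (bet) "\<exists>i\<in>S. \<exists>j\<in>{1..n} - S. 0 < A i j 3"
      unfolding B_NS_def by meson
    then show "\<exists>k i j. (k, i, j) \<in> edges n A \<and> i \<in> S \<and> j \<notin> S"
    proof cases
      case eq
      then obtain i j where "i \<in> S" "j \<in> {1..n} - S" "0 < A i j 2" by blast
      with S have "(Equal, i, j) \<in> edges n A" by (auto simp: edges_def)
      with \<open>i \<in> S\<close> \<open>j \<in> _\<close> show ?thesis by blast
    next
      case bet
      then obtain i j where "i \<in> S" "j \<in> {1..n} - S" "0 < A i j 3" by blast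
      with S have "(Better, i, j) \<in> edges n A" by (auto simp: edges_def)
      with \<open>i \<in> S\<close> \<open>j \<in> _\<close> show ?thesis by blast
    qed
  qed
next
  assume cuts: ?cuts
  show "B_NS n A"
    unfolding B_NS_def
  proof (intro allI impI)
    fix S T assume ST: "S \<union> T = {1..n} \<and> S \<inter> T = {} \<and> S \<noteq> {} \<and> T \<noteq> {}"
    have cut: "\<exists>k i j. (k, i, j) \<in> edges n A \<and> i \<in> X \<and> j \<in> Y"
      if "X \<union> Y = {1..n}" "X \<inter> Y = {}" "X \<noteq> {}" "Y \<noteq> {}" for X Y
    proof -
      have "X \<subseteq> {1..n} \<and> X \<noteq> {} \<and> X \<noteq> {1..n}" using that by blast
      with cuts obtain k i j where kij: "(k, i, j) \<in> edges n A" "i \<in> X" "j \<notin> X" by blast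
      moreover have "j \<in> {1..n}" using kij(1) GR_edge_verts by (auto simp: edges_def)
      ultimately show ?thesis using that by blast
    qed
    obtain k i j where kij: "(k, i, j) \<in> edges n A" "i \<in> S" "j \<in> T" using cut[of S T] ST by blast
    obtain k' i' j' where kij': "(k', i', j') \<in> edges n A" "i' \<in> T" "j' \<in> S"
      using cut[of T S] ST by blast
    show "(\<exists>i\<in>S. \<exists>j\<in>T. 0 < A i j 2) \<or>
      (\<exists>i\<^sub>1\<in>S. \<exists>j\<^sub>1\<in>T. \<exists>i\<^sub>2\<in>S. \<exists>j\<^sub>2\<in>T. 0 < A i\<^sub>1 j\<^sub>1 3 \<and> 0 < A i\<^sub>2 j\<^sub>2 1)"
    proof (cases "k = Equal \<or> k' = Equal")
      case True
      then show ?thesis using kij kij' assms Equal_edge_sym[OF assms, of i' j']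
        by (auto simp: edges_def)
    next
      case False
      then have "k = Better" "k' = Better" by (metis edge_kind.exhaust)+
      with kij kij' have "0 < A i j 3" "0 < A j' i' 1"
        using assms by (auto simp: edges_def data_matrix_def)
      with kij kij' show ?thesis by blast
    qed
  qed
qed

lemma B_NS_strongly_connected:
  assumes "data_matrix n A" "B_NS n A" "a \<in> {1..n}" "b \<in> {1..n}"
  shows "(a, b) \<in> {(i, j). \<exists>k. (k, i, j) \<in> edges n A}\<^sup>*"
proof (rule ccontr)
  let ?R = "{(i, j). \<exists>k. (k, i, j) \<in> edges n A}\<^sup>*"
  assume "(a, b) \<notin> ?R"
  let ?S = "{j \<in> {1..n}. (a, j) \<in> ?R}"
  have "?S \<subseteq> {1..n}" "a \<in> ?S" "b \<notin> ?S" using assms \<open>(a, b) \<notin> ?R\<close> by auto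
  with assms have "\<exists>k i j. (k, i, j) \<in> edges n A \<and> i \<in> ?S \<and> j \<notin> ?S"
    using B_NS_iff_cuts[OF assms(1)] by blast
  then obtain k i j where kij: "(k, i, j) \<in> edges n A" "i \<in> ?S" "j \<notin> ?S" by blast
  then have "j \<in> {1..n}" using GR_edge_verts by (auto simp: edges_def)
  moreover have "(a, j) \<in> ?R" using kij by (auto intro: rtrancl_into_rtrancl)
  ultimately show False using kij by blast
qed

section \<open>The likelihood as a sum over edges\<close>

text \<open>
  An `equal' observation appears as an edge in both directions, hence the factor one half.
\<close>

definition weight :: "(nat \<Rightarrow> nat \<Rightarrow> nat \<Rightarrow> nat) \<Rightarrow> edge_kind \<Rightarrow> nat \<Rightarrow> nat \<Rightarrow> real" where
  "weight A k i j = (case k of Better \<Rightarrow> real (A i j 3) | Equal \<Rightarrow> real (A i j 2) / 2)"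

lemma weight_pos: "(k, i, j) \<in> edges n A \<Longrightarrow> 0 < weight A k i j"
  by (cases k) (auto simp: edges_def weight_def)

text \<open>
  This passes from the likelihood, which visits each pair once, to directed edges, which makes all
  later arguments symmetric in the two objects.
\<close>

lemma sum_upper_triangle:
  fixes f :: "nat \<Rightarrow> nat \<Rightarrow> real"
  shows "(\<Sum>i=1..n-1. \<Sum>j=i+1..n. f i j + f j i) = (\<Sum>(i, j)\<in>{(i, j). i \<in> {1..n} \<and> j \<in> {1..n} \<and> i \<noteq> j}. f i j)"
proof -
  let ?U = "{(i, j). i \<in> {1..n} \<and> j \<in> {1..n} \<and> i < j}"
  let ?L = "{(i, j). i \<in> {1..n} \<and> j \<in> {1..n} \<and> j < i}"
  have fin: "finite ?U" "finite ?L" by (rule finite_subset[of _ "{1..n} \<times> {1..n}"]; auto)+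
  have U: "?U = Sigma {1..n-1} (\<lambda>i. {i+1..n})" by auto
  have "(\<Sum>(i, j)\<in>?L. f i j) = (\<Sum>(i, j)\<in>?U. f j i)"
    by (rule sum.reindex_bij_witness[of _ "\<lambda>(i, j). (j, i)" "\<lambda>(i, j). (j, i)"]) auto
  moreover have "(\<Sum>(i, j)\<in>{(i, j). i \<in> {1..n} \<and> j \<in> {1..n} \<and> i \<noteq> j}. f i j) =
      (\<Sum>(i, j)\<in>?U. f i j) + (\<Sum>(i, j)\<in>?L. f i j)"
    by (subst sum.union_disjoint[symmetric, OF fin]) (auto intro!: sum.cong)
  ultimately have "(\<Sum>(i, j)\<in>{(i, j). i \<in> {1..n} \<and> j \<in> {1..n} \<and> i \<noteq> j}. f i j) =
      (\<Sum>(i, j)\<in>?U. f i j + f j i)"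
    by (simp add: sum.distrib[symmetric] split_def)
  moreover have "(\<Sum>i=1..n-1. \<Sum>j=i+1..n. f i j + f j i) = (\<Sum>(i, j)\<in>?U. f i j + f j i)"
    unfolding U by (rule sum.Sigma) auto
  ultimately show ?thesis by simp
qed

lemma log_likelihood_eq_edge_sum:
  assumes data: "data_matrix n A"
    and q1: "\<And>i j. i \<in> {1..n} \<Longrightarrow> j \<in> {1..n} \<Longrightarrow> q i j 1 = P Better j i"
    and q2: "\<And>i j. i \<in> {1..n} \<Longrightarrow> j \<in> {1..n} \<Longrightarrow> q i j 2 = P Equal i j"
    and q3: "\<And>i j. i \<in> {1..n} \<Longrightarrow> j \<in> {1..n} \<Longrightarrow> q i j 3 = P Better i j"
    and sym: "\<And>i j. i \<in> {1..n} \<Longrightarrow> j \<in> {1..n} \<Longrightarrow> P Equal i j = P Equal j i"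
  shows "log_likelihood n A q = (\<Sum>(k, i, j)\<in>edges n A. weight A k i j * ln (P k i j))"
proof -
  let ?f = "\<lambda>i j. weight A Better i j * ln (P Better i j) + weight A Equal i j * ln (P Equal i j)"
  let ?N = "{(i, j). i \<in> {1..n} \<and> j \<in> {1..n} \<and> i \<noteq> j}"
  have N: "finite ?N" by (rule finite_subset[of _ "{1..n} \<times> {1..n}"]) auto
  have three: "{1..3::nat} = {1, 2, 3}" by auto
  have "log_likelihood n A q = (\<Sum>i=1..n-1. \<Sum>j=i+1..n. \<Sum>k=1..3. real (A i j k) * ln (q i j k))"
    unfolding log_likelihood_def
    by (subst sum.swap, rule sum.cong[OF refl], rule sum.swap)
  also have "\<dots> = (\<Sum>i=1..n-1. \<Sum>j=i+1..n. ?f i j + ?f j i)"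
  proof (intro sum.cong refl)
    fix i j assume "i \<in> {1..n-1}" "j \<in> {i+1..n}"
    then have ij: "i \<in> {1..n}" "j \<in> {1..n}" "i \<noteq> j" by auto
    then have "A i j 1 = A j i 3" "A i j 2 = A j i 2" using data by (auto simp: data_matrix_def)
    then show "(\<Sum>k=1..3. real (A i j k) * ln (q i j k)) = ?f i j + ?f j i"
      using q1[of i j] q2[of i j] q3[of i j] sym[of i j] ij
      unfolding three by (simp add: weight_def)
  qed
  also have "\<dots> = (\<Sum>(i, j)\<in>?N. ?f i j)" by (rule sum_upper_triangle)
  also have "\<dots> = (\<Sum>(k, i, j)\<in>UNIV \<times> ?N. weight A k i j * ln (P k i j))"
    unfolding sum.cartesian_product[symmetric]
    by (simp add: UNIV_edge_kind sum.distrib[symmetric] split_def)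
  also have "\<dots> = (\<Sum>(k, i, j)\<in>edges n A. weight A k i j * ln (P k i j))"
  proof (rule sum.mono_neutral_right)
    show "finite (UNIV \<times> ?N :: (edge_kind \<times> nat \<times> nat) set)"
      using N by (simp add: UNIV_edge_kind)
    show "edges n A \<subseteq> UNIV \<times> ?N" using GR_edge_verts by (fastforce simp: edges_def)
    have "weight A k i j = 0" if "(i, j) \<in> ?N" "(k, i, j) \<notin> edges n A" for k i j
      using that by (cases k) (auto simp: edges_def weight_def)
    then show "\<forall>e\<in>UNIV \<times> ?N - edges n A. (case e of (k, i, j) \<Rightarrow> weight A k i j * ln (P k i j)) = 0"
      by auto
  qed
  finally show ?thesis .
qed

section \<open>Threshold models for comparisons with ties\<close>

text \<open>
  The features shared by the two models. \<open>p k x d\<close> is the probability of the outcome along an edge of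
  kind \<open>k\<close> from \<open>i\<close> to \<open>j\<close> with \<open>x = m i - m j\<close>, and \<open>d\<close> is the threshold parameter, which ranges over an
  upward closed set \<open>D\<close> without least element. The monotonicity assumptions serve the necessity of the
  conditions; coercivity gives the existence of a maximizer. The strict midpoint inequalities are
  strict concavity of \<open>ln p\<close> in multiplicative form and give uniqueness. For `better' edges strictness
  is required only between points that differ in \<open>x - d\<close>, because in the Thurstone model that probability depends on
  \<open>x - d\<close> alone. In Davidson's model it also grows along lines of constant \<open>x - d\<close>, which is why
  \<open>Better_mono\<close> asks for \<open>x \<le> y\<close> as well.
\<close>

locale comparison_model =
  fixes D :: "real set" and p :: "edge_kind \<Rightarrow> real \<Rightarrow> real \<Rightarrow> real"
  assumes D_nonempty: "D \<noteq> {}"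
    and D_upward: "d \<in> D \<Longrightarrow> d \<le> e \<Longrightarrow> e \<in> D"
    and D_no_least: "d \<in> D \<Longrightarrow> \<exists>e\<in>D. e < d"
    and p_pos: "d \<in> D \<Longrightarrow> 0 < p k x d"
    and p_le_1: "d \<in> D \<Longrightarrow> p k x d \<le> 1"
    and p_cont: "continuous_on (UNIV \<times> D) (\<lambda>(x, d). p k x d)"
    and Better_mono: "d \<in> D \<Longrightarrow> e \<in> D \<Longrightarrow> x \<le> y \<Longrightarrow> e - d \<le> y - x \<Longrightarrow> p Better x d \<le> p Better y e"
    and Equal_mono: "d \<in> D \<Longrightarrow> e \<in> D \<Longrightarrow> \<bar>y - x\<bar> \<le> e - d \<Longrightarrow> p Equal x d \<le> p Equal y e"
    and coercive: "0 < \<epsilon> \<Longrightarrow> \<exists>c. \<forall>x. \<forall>d\<in>D. \<epsilon> \<le> p k x d \<longrightarrow> gain k * d - c \<le> x"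
    and Equal_lower: "0 < \<epsilon> \<Longrightarrow> \<exists>e\<in>D. \<forall>x. \<forall>d\<in>D. \<epsilon> \<le> p Equal x d \<longrightarrow> e \<le> d"
    and midpoint: "d \<in> D \<Longrightarrow> e \<in> D \<Longrightarrow> p k x d * p k y e \<le> (p k ((x + y) / 2) ((d + e) / 2))\<^sup>2"
    and Better_strict: "d \<in> D \<Longrightarrow> e \<in> D \<Longrightarrow> x - d \<noteq> y - e \<Longrightarrow>
      p Better x d * p Better y e < (p Better ((x + y) / 2) ((d + e) / 2))\<^sup>2"
    and Equal_strict: "d \<in> D \<Longrightarrow> e \<in> D \<Longrightarrow> (x, d) \<noteq> (y, e) \<Longrightarrow>
      p Equal x d * p Equal y e < (p Equal ((x + y) / 2) ((d + e) / 2))\<^sup>2"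
begin

definition params :: "nat \<Rightarrow> ((nat \<Rightarrow> real) \<times> real) set" where
  "params n = {(m, d). m \<in> {1..n} \<rightarrow>\<^sub>E UNIV \<and> m 1 = 0 \<and> d \<in> D}"

definition loglik :: "nat \<Rightarrow> (nat \<Rightarrow> nat \<Rightarrow> nat \<Rightarrow> nat) \<Rightarrow> (nat \<Rightarrow> real) \<times> real \<Rightarrow> real" where
  "loglik n A = (\<lambda>(m, d). \<Sum>(k, i, j)\<in>edges n A. weight A k i j * ln (p k (m i - m j) d))"

lemma loglik_mono:
  assumes "d \<in> D" "\<And>k i j. (k, i, j) \<in> edges n A \<Longrightarrow> p k (m i - m j) d \<le> p k (m' i - m' j) d'"
  shows "loglik n A (m, d) \<le> loglik n A (m', d')"
  unfolding loglik_def split_conv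
proof (rule sum_mono, clarify)
  fix k i j assume e: "(k, i, j) \<in> edges n A"
  from p_pos[OF assms(1)] assms(2)[OF e] have "ln (p k (m i - m j) d) \<le> ln (p k (m' i - m' j) d')"
    by (smt (verit) ln_le_cancel_iff)
  with weight_pos[OF e] show "weight A k i j * ln (p k (m i - m j) d) \<le> weight A k i j * ln (p k (m' i - m' j) d')"
    by (simp add: mult_left_mono)
qed

section \<open>Necessity of the conditions\<close>

text \<open>
  The common pattern of the three necessity proofs: if every parameter can be moved to a different
  one without lowering any observed probability, a maximizer would produce a second one.
\<close>

lemma no_nondecreasing_move:
  assumes unique: "\<exists>!\<theta>. is_arg_max (loglik n A) (\<lambda>\<theta>. \<theta> \<in> params n) \<theta>"
    and move: "\<And>m d. (m, d) \<in> params n \<Longrightarrow> \<exists>m' d'. (m', d') \<in> params n \<and> (m', d') \<noteq> (m, d) \<and>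
      (\<forall>(k, i, j)\<in>edges n A. p k (m i - m j) d \<le> p k (m' i - m' j) d')"
  shows False
proof -
  obtain m d where max: "is_arg_max (loglik n A) (\<lambda>\<theta>. \<theta> \<in> params n) (m, d)"
    using unique by (metis surj_pair)
  then have par: "(m, d) \<in> params n" and d: "d \<in> D" by (auto simp: is_arg_max_def params_def)
  from move[OF par] obtain m' d' where md': "(m', d') \<in> params n" "(m', d') \<noteq> (m, d)"
    "\<And>k i j. (k, i, j) \<in> edges n A \<Longrightarrow> p k (m i - m j) d \<le> p k (m' i - m' j) d'" by fast
  have "loglik n A (m, d) \<le> loglik n A (m', d')" by (rule loglik_mono[OF d md'(3)])
  with max md'(1) have "is_arg_max (loglik n A) (\<lambda>\<theta>. \<theta> \<in> params n) (m', d')"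
    by (auto simp: is_arg_max_linorder intro: order_trans)
  with unique max md'(2) show False by blast
qed

text \<open>
  Without `equal' observations, lowering the threshold makes no `better' observation less likely.
\<close>

lemma unique_imp_A_NS:
  assumes "\<exists>!\<theta>. is_arg_max (loglik n A) (\<lambda>\<theta>. \<theta> \<in> params n) \<theta>"
  shows "A_NS n A"
proof (rule ccontr)
  assume nA: "\<not> A_NS n A"
  show False
  proof (rule no_nondecreasing_move[OF assms])
    fix m d assume md: "(m, d) \<in> params n"
    then have d: "d \<in> D" by (simp add: params_def)
    then obtain e where e: "e \<in> D" "e < d" using D_no_least by blast
    have "p k (m i - m j) d \<le> p k (m i - m j) e" if "(k, i, j) \<in> edges n A" for k i j
    proof -
      have "k = Better" using that nA by (cases k) (fastforce simp: edges_def A_NS_def)+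
      then show ?thesis using Better_mono[OF d e(1)] e(2) by simp
    qed
    with md e show "\<exists>m' d'. (m', d') \<in> params n \<and> (m', d') \<noteq> (m, d) \<and>
      (\<forall>(k, i, j)\<in>edges n A. p k (m i - m j) d \<le> p k (m' i - m' j) d')"
      by (intro exI[of _ m] exI[of _ e]) (auto simp: params_def)
  qed
qed

text \<open>
  If no edge leaves \<open>S\<close>, then no `equal' edge crosses the cut and the crossing `better' edges all start
  outside \<open>S\<close>. So the objects outside \<open>S\<close> can be raised together; subtracting the shift of object 1
  restores the normalization.
\<close>

lemma unique_imp_B_NS:
  assumes data: "data_matrix n A" and n: "1 \<le> n"
    and unique: "\<exists>!\<theta>. is_arg_max (loglik n A) (\<lambda>\<theta>. \<theta> \<in> params n) \<theta>"
  shows "B_NS n A"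
proof (rule ccontr)
  assume "\<not> B_NS n A"
  then obtain S where S: "S \<subseteq> {1..n}" "S \<noteq> {}" "S \<noteq> {1..n}"
    and cut: "\<And>k i j. (k, i, j) \<in> edges n A \<Longrightarrow> i \<in> S \<Longrightarrow> j \<in> S"
    using B_NS_iff_cuts[OF data] by blast
  show False
  proof (rule no_nondecreasing_move[OF unique])
    fix m d assume md: "(m, d) \<in> params n"
    then have d: "d \<in> D" and m: "m \<in> {1..n} \<rightarrow>\<^sub>E UNIV" "m 1 = 0" by (simp_all add: params_def)
    define u :: "nat \<Rightarrow> real" where "u = (\<lambda>i. if i \<in> S then 0 else 1)"
    define m' where "m' = (\<lambda>i\<in>{1..n}. m i + u i - u 1)"
    have diff: "m' i - m' j = m i - m j + (u i - u j)" if "i \<in> {1..n}" "j \<in> {1..n}" for i j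
      using that by (simp add: m'_def)
    have "p k (m i - m j) d \<le> p k (m' i - m' j) d" if e: "(k, i, j) \<in> edges n A" for k i j
    proof -
      have ij: "i \<in> {1..n}" "j \<in> {1..n}" using e GR_edge_verts by (auto simp: edges_def)
      show ?thesis
      proof (cases k)
        case Better
        have "u j \<le> u i" using cut[OF e] by (simp add: u_def)
        then show ?thesis using Better_mono[OF d d] diff[OF ij] Better by simp
      next
        case Equal
        then have "u j = u i" using cut[OF e] cut[OF Equal_edge_sym[OF data]] e by (auto simp: u_def)
        then show ?thesis using diff[OF ij] by simp
      qed
    qed
    moreover have "m' \<noteq> m"
    proof
      assume "m' = m"
      obtain i j where ij: "i \<in> S" "j \<notin> S" "i \<in> {1..n}" "j \<in> {1..n}" using S by blast
      with diff[of i j] \<open>m' = m\<close> show False by (simp add: u_def)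
    qed
    moreover have "(m', d) \<in> params n" using d m n by (simp add: params_def m'_def)
    ultimately show "\<exists>m' d'. (m', d') \<in> params n \<and> (m', d') \<noteq> (m, d) \<and>
      (\<forall>(k, i, j)\<in>edges n A. p k (m i - m j) d \<le> p k (m' i - m' j) d')"
      by (intro exI[of _ m'] exI[of _ d]) auto
  qed
qed

text \<open>
  Moving \<open>(m, d)\<close> by \<open>(v, 1)\<close> for a potential \<open>v\<close> raises \<open>m i - m j\<close> by at least 1 along `better' edges
  and changes it by at most 1 along `equal' edges, just what monotonicity asks for when \<open>d\<close> rises by 1.
\<close>

lemma unique_imp_C_NS:
  assumes data: "data_matrix n A" and n: "1 \<le> n"
    and unique: "\<exists>!\<theta>. is_arg_max (loglik n A) (\<lambda>\<theta>. \<theta> \<in> params n) \<theta>"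
  shows "C_NS n A"
proof (rule ccontr)
  assume "\<not> C_NS n A"
  from not_C_NS_potential[OF this] obtain v :: "nat \<Rightarrow> real"
    where v: "\<And>k i j. (k, i, j) \<in> edges n A \<Longrightarrow> gain k \<le> v i - v j" by fast
  show False
  proof (rule no_nondecreasing_move[OF unique])
    fix m d assume md: "(m, d) \<in> params n"
    then have d: "d \<in> D" "d + 1 \<in> D" and m: "m \<in> {1..n} \<rightarrow>\<^sub>E UNIV" "m 1 = 0"
      using D_upward[of d "d + 1"] by (simp_all add: params_def)
    define m' where "m' = (\<lambda>i\<in>{1..n}. m i + v i - v 1)"
    have "p k (m i - m j) d \<le> p k (m' i - m' j) (d + 1)" if e: "(k, i, j) \<in> edges n A" for k i j
    proof -
      have ij: "i \<in> {1..n}" "j \<in> {1..n}" using e GR_edge_verts by (auto simp: edges_def)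
      then have diff: "m' i - m' j = m i - m j + (v i - v j)" by (simp add: m'_def)
      show ?thesis
      proof (cases k)
        case Better
        then show ?thesis using Better_mono[OF d] diff v[OF e] by simp
      next
        case Equal
        then have "\<bar>v i - v j\<bar> \<le> 1" using v[OF e] v[OF Equal_edge_sym[OF data]] e by fastforce
        then show ?thesis using Equal_mono[OF d] diff Equal by simp
      qed
    qed
    moreover have "(m', d + 1) \<in> params n" using d m n by (simp add: params_def m'_def)
    ultimately show "\<exists>m' d'. (m', d') \<in> params n \<and> (m', d') \<noteq> (m, d) \<and>
      (\<forall>(k, i, j)\<in>edges n A. p k (m i - m j) d \<le> p k (m' i - m' j) d')"
      by (intro exI[of _ m'] exI[of _ "d + 1"]) auto
  qed
qed

section \<open>Existence of the maximizer\<close>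

text \<open>
  All summands of the log-likelihood are nonpositive, so a lower bound on the sum is a lower bound on
  each of them.
\<close>

lemma superlevel_edge_bound:
  obtains \<epsilon> where "0 < \<epsilon>"
    "\<And>m d k i j. d \<in> D \<Longrightarrow> K \<le> loglik n A (m, d) \<Longrightarrow> (k, i, j) \<in> edges n A \<Longrightarrow> \<epsilon> \<le> p k (m i - m j) d"
proof -
  \<comment> \<open>the inserted 1 only keeps the minimum defined when there are no edges\<close>
  define w where "w = Min (insert 1 ((\<lambda>(k, i, j). weight A k i j) ` edges n A))"
  have fin: "finite (insert 1 ((\<lambda>(k, i, j). weight A k i j) ` edges n A))"
    using finite_edges by simp
  have w: "0 < w" unfolding w_def
    using weight_pos by (subst Min_gr_iff[OF fin]) auto
  have w_le: "w \<le> weight A k i j" if "(k, i, j) \<in> edges n A" for k i j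
    unfolding w_def by (rule Min_le[OF fin]) (use that in force)
  have "exp (K / w) \<le> p k (m i - m j) d"
    if d: "d \<in> D" and K: "K \<le> loglik n A (m, d)" and e: "(k, i, j) \<in> edges n A" for m d k i j
  proof -
    let ?t = "\<lambda>(k, i, j). weight A k i j * ln (p k (m i - m j) d)"
    have neg: "?t a \<le> 0" if "a \<in> edges n A" for a
      using that p_pos[OF d] p_le_1[OF d] weight_pos
      by (auto split: prod.splits intro!: mult_nonneg_nonpos simp: less_imp_le)
    have ln0: "ln (p k (m i - m j) d) \<le> 0" using p_pos[OF d] p_le_1[OF d] by simp
    have "K \<le> (\<Sum>a\<in>edges n A. ?t a)" using K by (simp add: loglik_def)
    also have "\<dots> = ?t (k, i, j) + (\<Sum>a\<in>edges n A - {(k, i, j)}. ?t a)"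
      by (rule sum.remove[OF finite_edges e])
    also have "(\<Sum>a\<in>edges n A - {(k, i, j)}. ?t a) \<le> 0" by (rule sum_nonpos) (use neg in blast)
    also have "?t (k, i, j) + 0 \<le> w * ln (p k (m i - m j) d)"
      using mult_right_mono_neg[OF w_le[OF e] ln0] by simp
    finally have "K / w \<le> ln (p k (m i - m j) d)" using w by (simp add: field_simps)
    then show ?thesis using p_pos[OF d] by (simp add: ln_ge_iff)
  qed
  then show thesis by (intro that[of "exp (K / w)"]) auto
qed

lemma superlevel_difference_bound:
  obtains c where "\<And>m d k i j. d \<in> D \<Longrightarrow> K \<le> loglik n A (m, d) \<Longrightarrow> (k, i, j) \<in> edges n A \<Longrightarrow>
    gain k * d - c \<le> m i - m j"
proof -
  obtain \<epsilon> where eps: "0 < \<epsilon>" "\<And>m d k i j. d \<in> D \<Longrightarrow> K \<le> loglik n A (m, d) \<Longrightarrow>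
      (k, i, j) \<in> edges n A \<Longrightarrow> \<epsilon> \<le> p k (m i - m j) d"
    by (rule superlevel_edge_bound) blast
  obtain c where c: "\<And>k x d. d \<in> D \<Longrightarrow> \<epsilon> \<le> p k x d \<Longrightarrow> gain k * d - c k \<le> x"
    using coercive[OF eps(1)] by metis
  have "c k \<le> max (c Better) (c Equal)" for k by (cases k) auto
  with c eps(2) have "gain k * d - max (c Better) (c Equal) \<le> m i - m j"
    if "d \<in> D" "K \<le> loglik n A (m, d)" "(k, i, j) \<in> edges n A" for m d k i j
    using that by (smt (verit))
  then show thesis using that by blast
qed

text \<open>
  Each condition bounds one direction of a superlevel set: an `equal' observation bounds the threshold
  from below, a cycle of positive gain bounds it from above, and, once the threshold is bounded,
  walks from and to object 1 bound every \<open>m i\<close> from both sides.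
\<close>

lemma superlevel_bounded:
  assumes data: "data_matrix n A" and n: "1 \<le> n" and A: "A_NS n A" and B: "B_NS n A" and C: "C_NS n A"
  obtains d\<^sub>0 d\<^sub>1 M where "d\<^sub>0 \<in> D"
    "\<And>m d. (m, d) \<in> params n \<Longrightarrow> K \<le> loglik n A (m, d) \<Longrightarrow>
      d\<^sub>0 \<le> d \<and> d \<le> d\<^sub>1 \<and> (\<forall>i\<in>{1..n}. \<bar>m i\<bar> \<le> M)"
proof -
  let ?lev = "\<lambda>m d. (m, d) \<in> params n \<and> K \<le> loglik n A (m, d)"
  have D: "d \<in> D" if "?lev m d" for m d using that by (simp add: params_def)
  obtain \<epsilon> where eps: "0 < \<epsilon>" "\<And>m d k i j. d \<in> D \<Longrightarrow> K \<le> loglik n A (m, d) \<Longrightarrow>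
      (k, i, j) \<in> edges n A \<Longrightarrow> \<epsilon> \<le> p k (m i - m j) d"
    by (rule superlevel_edge_bound) blast
  obtain c where c: "\<And>m d k i j. d \<in> D \<Longrightarrow> K \<le> loglik n A (m, d) \<Longrightarrow> (k, i, j) \<in> edges n A \<Longrightarrow>
      gain k * d - c \<le> m i - m j"
    by (rule superlevel_difference_bound) blast
  obtain d\<^sub>0 where d0: "d\<^sub>0 \<in> D" "\<And>x d. d \<in> D \<Longrightarrow> \<epsilon> \<le> p Equal x d \<Longrightarrow> d\<^sub>0 \<le> d"
    using Equal_lower[OF eps(1)] by blast
  obtain a b where ab: "(Equal, a, b) \<in> edges n A" using A by (auto simp: A_NS_def edges_def)
  have low: "d\<^sub>0 \<le> d" if "?lev m d" for m d using d0(2) eps(2) ab D that by blast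
  obtain l g where lg: "0 < g" "\<And>(m :: nat \<Rightarrow> real) d c.
      (\<And>k i j. (k, i, j) \<in> edges n A \<Longrightarrow> gain k * d - c \<le> m i - m j) \<Longrightarrow> g * d \<le> l * c"
    by (rule C_NS_bounds[OF C]) blast
  define d\<^sub>1 where "d\<^sub>1 = l * c / g"
  have up: "d \<le> d\<^sub>1" if "?lev m d" for m d
  proof -
    have "g * d \<le> l * c" by (rule lg(2)[of d c m]) (use c D that in blast)
    then show ?thesis using lg(1) by (simp add: d\<^sub>1_def field_simps)
  qed
  define C' where "C' = \<bar>d\<^sub>0\<bar> + \<bar>d\<^sub>1\<bar> + c"
  have edge: "- C' \<le> m i - m j" if "(k, i, j) \<in> edges n A" "?lev m d" for m d k i j
  proof -
    have "gain k * d - c \<le> m i - m j" using c D that by blast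
    moreover have "\<bar>gain k * d\<bar> \<le> \<bar>d\<^sub>0\<bar> + \<bar>d\<^sub>1\<bar>" using low[OF that(2)] up[OF that(2)] by (cases k) auto
    ultimately show ?thesis by (simp add: C'_def)
  qed
  have path: "\<exists>C. \<forall>m d. ?lev m d \<longrightarrow> - C \<le> m i - m j"
    if "(i, j) \<in> {(i, j). \<exists>k. (k, i, j) \<in> edges n A}\<^sup>*" for i j
    using that
  proof (induction rule: rtrancl_induct)
    case base
    show ?case by (intro exI[of _ 0]) simp
  next
    case (step j l)
    then obtain C k where "\<And>m d. ?lev m d \<Longrightarrow> - C \<le> m i - m j" "(k, j, l) \<in> edges n A" by blast
    with edge have "\<forall>m d. ?lev m d \<longrightarrow> - (C + C') \<le> m i - m l" by (smt (verit))
    then show ?case by blast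
  qed
  have "\<exists>C. \<forall>m d. ?lev m d \<longrightarrow> \<bar>m i\<bar> \<le> C" if i: "i \<in> {1..n}" for i
  proof -
    have one: "1 \<in> {1..n}" using n by simp
    obtain C1 where C1: "\<And>m d. ?lev m d \<Longrightarrow> - C1 \<le> m i - m 1"
      using path[OF B_NS_strongly_connected[OF data B i one]] by blast
    obtain C2 where C2: "\<And>m d. ?lev m d \<Longrightarrow> - C2 \<le> m 1 - m i"
      using path[OF B_NS_strongly_connected[OF data B one i]] by blast
    have "\<bar>m i\<bar> \<le> max C1 C2" if "?lev m d" for m d
    proof -
      have "m 1 = 0" using that by (simp add: params_def)
      with C1[OF that] C2[OF that] show ?thesis by simp
    qed
    then show ?thesis by blast
  qed
  then obtain R where R: "\<And>i m d. i \<in> {1..n} \<Longrightarrow> ?lev m d \<Longrightarrow> \<bar>m i\<bar> \<le> R i" by metis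
  have "\<bar>m i\<bar> \<le> Max (R ` {1..n})" if "i \<in> {1..n}" "?lev m d" for i m d
    using R[OF that] that(1) by (meson Max_ge finite_atLeastAtMost finite_imageI image_eqI order_trans)
  with low up show thesis by (intro that[of d\<^sub>0 d\<^sub>1 "Max (R ` {1..n})"] d0(1)) blast
qed

lemma continuous_on_loglik: "continuous_on (UNIV \<times> D) (loglik n A)"
proof -
  have "continuous_on (UNIV \<times> D) (\<lambda>\<theta>. p k (fst \<theta> i - fst \<theta> j) (snd \<theta>))"
    for k and i j :: nat
  proof -
    have coord: "continuous_on (UNIV \<times> D) (\<lambda>\<theta>. fst \<theta> i :: real)" for i :: nat
      by (rule continuous_on_compose2[OF continuous_on_product_coordinates[of i]])
        (auto intro: continuous_intros)
    have "continuous_on (UNIV \<times> D) (\<lambda>\<theta>. (fst \<theta> i - fst \<theta> j :: real, snd \<theta>))"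
      by (intro continuous_intros coord)
    moreover have "(\<lambda>\<theta>. (fst \<theta> i - fst \<theta> j, snd \<theta>)) ` (UNIV \<times> D) \<subseteq> UNIV \<times> D"
      by (auto simp: mem_Times_iff)
    ultimately show ?thesis using continuous_on_compose2[OF p_cont[of k]] by fastforce
  qed
  moreover have "p k x d \<noteq> 0" if "d \<in> D" for k x d using p_pos[OF that, of k x] by simp
  ultimately have "continuous_on (UNIV \<times> D) (\<lambda>\<theta>. \<Sum>(k, i, j)\<in>edges n A.
      weight A k i j * ln (p k (fst \<theta> i - fst \<theta> j) (snd \<theta>)))"
    by (auto intro!: continuous_intros simp: split_def)
  then show ?thesis by (simp add: loglik_def split_def)
qed

text \<open>
  The log-likelihood is maximized over a compact box that contains a nonempty superlevel set.
  Coordinates outside \<open>{1..n}\<close> are pinned to \<open>undefined\<close>, so the box is a product of compact sets inside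
  the parameter space.
\<close>

lemma maximum_attained:
  assumes data: "data_matrix n A" and n: "1 \<le> n" and ABC: "A_NS n A" "B_NS n A" "C_NS n A"
  shows "\<exists>\<theta>. is_arg_max (loglik n A) (\<lambda>\<theta>. \<theta> \<in> params n) \<theta>"
proof -
  obtain d where d: "d \<in> D" using D_nonempty by blast
  define m where "m = (\<lambda>i\<in>{1..n}. 0 :: real)"
  have md: "(m, d) \<in> params n" using d n by (simp add: params_def m_def)
  define K where "K = loglik n A (m, d)"
  obtain d\<^sub>0 d\<^sub>1 M where d0: "d\<^sub>0 \<in> D" and box: "\<And>m d. (m, d) \<in> params n \<Longrightarrow> K \<le> loglik n A (m, d) \<Longrightarrow>
      d\<^sub>0 \<le> d \<and> d \<le> d\<^sub>1 \<and> (\<forall>i\<in>{1..n}. \<bar>m i\<bar> \<le> M)"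
    by (rule superlevel_bounded[OF data n ABC]) blast
  define I where "I = (\<lambda>i :: nat. if i = 1 then {0} else if i \<in> {1..n} then {- M..M} else {undefined :: real})"
  have I_undef: "x = undefined" if "x \<in> I i" "i \<notin> {1..n}" for x i
    using that n by (auto simp: I_def split: if_splits)
  define Q where "Q = PiE UNIV I \<times> {d\<^sub>0..d\<^sub>1}"
  have "compactin (product_topology (\<lambda>_. euclidean) UNIV) (PiE UNIV I)"
    unfolding compactin_PiE by (auto simp: I_def)
  then have "compact (PiE UNIV I)" by (simp add: euclidean_product_topology)
  then have "compact Q" unfolding Q_def by (intro compact_Times) auto
  moreover have Q_level: "\<theta> \<in> Q" if th: "\<theta> \<in> params n" "K \<le> loglik n A \<theta>" for \<theta>
  proof -
    obtain m d where th': "\<theta> = (m, d)" by fastforce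
    have b: "d\<^sub>0 \<le> d" "d \<le> d\<^sub>1" "\<And>i. i \<in> {1..n} \<Longrightarrow> \<bar>m i\<bar> \<le> M" using box[of m d] th th' by auto
    have "m i \<in> I i" for i
    proof (cases "i \<in> {1..n}")
      case True
      then show ?thesis using b(3)[OF True] th(1) th' by (auto simp: I_def params_def abs_le_iff)
    next
      case False
      then show ?thesis using th(1) th' n by (auto simp: I_def params_def)
    qed
    then show ?thesis using b th' by (auto simp: Q_def)
  qed
  moreover have "Q \<subseteq> params n"
  proof
    fix \<theta> assume "\<theta> \<in> Q"
    then obtain m d where th: "\<theta> = (m, d)" and mI: "m \<in> PiE UNIV I" and dd: "d\<^sub>0 \<le> d"
      by (auto simp: Q_def)
    have m: "m i \<in> I i" for i using mI by auto
    have "m \<in> {1..n} \<rightarrow>\<^sub>E UNIV" using m I_undef by (intro PiE_I) auto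
    moreover have "m 1 = 0" using m[of 1] by (simp add: I_def)
    ultimately show "\<theta> \<in> params n" using D_upward[OF d0 dd] by (simp add: th params_def)
  qed
  moreover have "continuous_on Q (loglik n A)"
    by (rule continuous_on_subset[OF continuous_on_loglik]) (use \<open>Q \<subseteq> params n\<close> in \<open>auto simp: params_def\<close>)
  moreover have mdQ: "(m, d) \<in> Q" using Q_level[OF md] by (simp add: K_def)
  ultimately obtain \<theta> where th: "\<theta> \<in> Q" "\<And>\<eta>. \<eta> \<in> Q \<Longrightarrow> loglik n A \<eta> \<le> loglik n A \<theta>"
    using continuous_attains_sup[of Q "loglik n A"] by blast
  have "loglik n A \<eta> \<le> loglik n A \<theta>" if "\<eta> \<in> params n" for \<eta>
  proof (cases "K \<le> loglik n A \<eta>")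
    case True
    then show ?thesis using th(2) Q_level that by blast
  next
    case False
    then show ?thesis using th(2)[OF mdQ] by (simp add: K_def)
  qed
  with th(1) \<open>Q \<subseteq> params n\<close> show ?thesis unfolding is_arg_max_linorder by blast
qed

section \<open>Uniqueness of the maximizer\<close>

text \<open>
  At the midpoint \<open>(a, b)\<close> of two maximizers every summand is at least the average, and the sum cannot
  exceed the maximum, so every midpoint inequality is tight. Strictness along an `equal' edge
  identifies the thresholds; then all differences along edges agree, and connectedness together with
  \<open>m 1 = 0\<close> identifies the vectors.
\<close>

lemma maximizer_unique:
  assumes data: "data_matrix n A" and n: "1 \<le> n" and A: "A_NS n A" and B: "B_NS n A"
    and max: "is_arg_max (loglik n A) (\<lambda>\<theta>. \<theta> \<in> params n) (m, d)"
             "is_arg_max (loglik n A) (\<lambda>\<theta>. \<theta> \<in> params n) (m', d')"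
  shows "(m, d) = (m', d')"
proof -
  have par: "m \<in> {1..n} \<rightarrow>\<^sub>E UNIV" "m 1 = 0" "d \<in> D" "m' \<in> {1..n} \<rightarrow>\<^sub>E UNIV" "m' 1 = 0" "d' \<in> D"
    using max by (auto simp: is_arg_max_def params_def)
  define a where "a = (\<lambda>i\<in>{1..n}. (m i + m' i) / 2)"
  define b where "b = (d + d') / 2"
  have b: "b \<in> D" using D_upward[OF par(3), of b] D_upward[OF par(6), of b] by (cases "d \<le> d'") (auto simp: b_def)
  have "(a, b) \<in> params n" using par n b by (auto simp: params_def a_def)
  with max have top: "loglik n A (a, b) \<le> loglik n A (m, d)" "loglik n A (m', d') = loglik n A (m, d)"
    by (auto simp: is_arg_max_linorder intro: antisym)
  \<comment> \<open>twice the weighted excess of the midpoint value over the average, edge by edge\<close>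
  define t where "t = (\<lambda>(k, i, j). weight A k i j *
      (2 * ln (p k (a i - a j) b) - ln (p k (m i - m j) d) - ln (p k (m' i - m' j) d')))"
  have diff: "a i - a j = ((m i - m j) + (m' i - m' j)) / 2" if "(k, i, j) \<in> edges n A" for k i j
  proof -
    have "i \<in> {1..n}" "j \<in> {1..n}" using that GR_edge_verts by (auto simp: edges_def)
    then show ?thesis by (simp add: a_def field_simps)
  qed
  have ln2: "2 * ln z - ln x - ln y = ln (z\<^sup>2) - ln (x * y)" if "0 < x" "0 < y" "0 < z" for x y z :: real
    using that by (simp add: ln_mult power2_eq_square)
  have t_eq: "t (k, i, j) = weight A k i j * (ln ((p k (a i - a j) b)\<^sup>2) -
      ln (p k (m i - m j) d * p k (m' i - m' j) d'))" for k i j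
    unfolding t_def split_conv by (subst ln2) (use p_pos par b in auto)
  have nonneg: "0 \<le> t e" if "e \<in> edges n A" for e
  proof -
    obtain k i j where e: "e = (k, i, j)" by (metis surj_pair)
    have "p k (m i - m j) d * p k (m' i - m' j) d' \<le> (p k (a i - a j) b)\<^sup>2"
      unfolding b_def diff[OF that[unfolded e]] by (rule midpoint[OF par(3) par(6)])
    moreover have "0 < p k (m i - m j) d * p k (m' i - m' j) d'" using p_pos par by simp
    ultimately have "0 \<le> ln ((p k (a i - a j) b)\<^sup>2) - ln (p k (m i - m j) d * p k (m' i - m' j) d')"
      by (smt (verit) ln_le_cancel_iff)
    with weight_pos[OF that[unfolded e]] show ?thesis by (simp add: t_eq e)
  qed
  have "(\<Sum>e\<in>edges n A. t e) = 2 * loglik n A (a, b) - loglik n A (m, d) - loglik n A (m', d')"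
    by (simp add: loglik_def t_def split_def sum_subtractf right_diff_distrib sum_distrib_left mult_ac)
  also have "\<dots> \<le> 0" using top by simp
  finally have "(\<Sum>e\<in>edges n A. t e) = 0" using sum_nonneg[of "edges n A" t] nonneg by fastforce
  then have zero: "t e = 0" if "e \<in> edges n A" for e
    using sum_nonneg_eq_0_iff[OF finite_edges] nonneg that by blast
  have tight: "\<not> p k (m i - m j) d * p k (m' i - m' j) d' < (p k (a i - a j) b)\<^sup>2"
    if "(k, i, j) \<in> edges n A" for k i j
  proof
    assume "p k (m i - m j) d * p k (m' i - m' j) d' < (p k (a i - a j) b)\<^sup>2"
    moreover have "0 < p k (m i - m j) d * p k (m' i - m' j) d'" using p_pos par by simp
    ultimately have "0 < ln ((p k (a i - a j) b)\<^sup>2) - ln (p k (m i - m j) d * p k (m' i - m' j) d')"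
      by (smt (verit) ln_less_cancel_iff)
    then have "0 < t (k, i, j)" using weight_pos[OF that] by (simp add: t_eq)
    with zero[OF that] show False by simp
  qed
  have eqE: "(m i - m j, d) = (m' i - m' j, d')" if "(Equal, i, j) \<in> edges n A" for i j
    using Equal_strict[OF par(3) par(6), of "m i - m j" "m' i - m' j"] tight[OF that]
    unfolding b_def diff[OF that] by blast
  have eqB: "m i - m j - d = m' i - m' j - d'" if "(Better, i, j) \<in> edges n A" for i j
    using Better_strict[OF par(3) par(6), of "m i - m j" "m' i - m' j"] tight[OF that]
    unfolding b_def diff[OF that] by blast
  obtain r s where "(Equal, r, s) \<in> edges n A" using A by (auto simp: A_NS_def edges_def)
  then have dd: "d = d'" using eqE by blast
  have edge: "m i - m' i = m j - m' j" if "(k, i, j) \<in> edges n A" for k i j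
    using that eqE[of i j] eqB[of i j] dd by (cases k) auto
  have path: "m i - m' i = m j - m' j" if "(i, j) \<in> {(i, j). \<exists>k. (k, i, j) \<in> edges n A}\<^sup>*" for i j
    using that by (induction rule: rtrancl_induct) (use edge in fastforce)+
  have "m i = m' i" for i
  proof (cases "i \<in> {1..n}")
    case True
    then show ?thesis using path[OF B_NS_strongly_connected[OF data B, of 1 i]] n par by simp
  next
    case False
    then show ?thesis using par by (metis PiE_arb)
  qed
  with dd show ?thesis by auto
qed

theorem unique_maximizer_iff:
  assumes "data_matrix n A" "1 \<le> n"
  shows "(\<exists>!\<theta>. is_arg_max (loglik n A) (\<lambda>\<theta>. \<theta> \<in> params n) \<theta>) \<longleftrightarrow> A_NS n A \<and> B_NS n A \<and> C_NS n A"
proof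
  assume "\<exists>!\<theta>. is_arg_max (loglik n A) (\<lambda>\<theta>. \<theta> \<in> params n) \<theta>"
  then show "A_NS n A \<and> B_NS n A \<and> C_NS n A"
    using unique_imp_A_NS unique_imp_B_NS[OF assms] unique_imp_C_NS[OF assms] by blast
next
  assume ABC: "A_NS n A \<and> B_NS n A \<and> C_NS n A"
  then obtain \<theta> where "is_arg_max (loglik n A) (\<lambda>\<theta>. \<theta> \<in> params n) \<theta>"
    using maximum_attained[OF assms] by blast
  moreover have "\<eta> = \<theta>" if "is_arg_max (loglik n A) (\<lambda>\<theta>. \<theta> \<in> params n) \<eta>"
    "is_arg_max (loglik n A) (\<lambda>\<theta>. \<theta> \<in> params n) \<theta>" for \<eta> \<theta>
    using maximizer_unique[OF assms, of "fst \<eta>" "snd \<eta>" "fst \<theta>" "snd \<theta>"] ABC that by simp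
  ultimately show "\<exists>!\<theta>. is_arg_max (loglik n A) (\<lambda>\<theta>. \<theta> \<in> params n) \<theta>" by blast
qed

end

section \<open>Log-concavity of distribution functions and increments\<close>

text \<open>
  The curvature hypothesis \<open>h h'' < h'\<^sup>2\<close> says that the logarithmic derivative \<open>h' / h\<close> is strictly
  decreasing.
\<close>

lemma strict_log_midpoint:
  fixes h h1 h2 :: "real \<Rightarrow> real"
  assumes h: "\<And>t. (h has_real_derivative h1 t) (at t)"
    and h1: "\<And>t. (h1 has_real_derivative h2 t) (at t)"
    and pos: "\<And>t. 0 \<le> t \<Longrightarrow> t \<le> 1 \<Longrightarrow> 0 < h t"
    and curv: "\<And>t. 0 \<le> t \<Longrightarrow> t \<le> 1 \<Longrightarrow> h t * h2 t < (h1 t)\<^sup>2"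
  shows "h 0 * h 1 < (h (1 / 2))\<^sup>2"
proof -
  let ?q = "\<lambda>t. h1 t / h t"
  have ln_h: "((\<lambda>t. ln (h t)) has_real_derivative ?q t) (at t)" if "0 \<le> t" "t \<le> 1" for t
    using pos[OF that] by (auto intro!: derivative_eq_intros h simp: field_simps)
  have q_dec: "?q t < ?q s" if "0 \<le> s" "s < t" "t \<le> 1" for s t
  proof (rule DERIV_neg_imp_decreasing[OF that(2)])
    fix u assume "s \<le> u" "u \<le> t"
    with that have u: "0 \<le> u" "u \<le> 1" by auto
    then have "(?q has_real_derivative (h2 u * h u - h1 u * h1 u) / (h u * h u)) (at u)"
      using pos[OF u] by (auto intro!: derivative_eq_intros h h1)
    moreover have "(h2 u * h u - h1 u * h1 u) / (h u * h u) < 0"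
      using curv[OF u] pos[OF u] by (simp add: divide_neg_pos power2_eq_square mult.commute)
    ultimately show "\<exists>y. (?q has_real_derivative y) (at u) \<and> y < 0" by blast
  qed
  obtain a where a: "0 < a" "a < 1 / 2" "ln (h (1 / 2)) - ln (h 0) = (1 / 2 - 0) * ?q a"
    using MVT2[of 0 "1 / 2" "\<lambda>t. ln (h t)" ?q] ln_h by auto
  obtain b where b: "1 / 2 < b" "b < 1" "ln (h 1) - ln (h (1 / 2)) = (1 - 1 / 2) * ?q b"
    using MVT2[of "1 / 2" 1 "\<lambda>t. ln (h t)" ?q] ln_h by auto
  have "?q b < ?q a" using q_dec a b by simp
  with a(3) b(3) have "ln (h 0) + ln (h 1) < 2 * ln (h (1 / 2))" by simp
  then have "ln (h 0 * h 1) < ln ((h (1 / 2))\<^sup>2)"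
    using pos[of 0] pos[of 1] pos[of "1 / 2"] by (simp add: ln_mult ln_realpow)
  then show ?thesis using pos[of 0] pos[of 1] pos[of "1 / 2"] by simp
qed

text \<open>
  What the Thurstone model uses of a distribution function \<open>F\<close> in the class, with the derivatives \<open>f\<close>
  and \<open>f'\<close> named.
\<close>

locale log_concave_distribution =
  fixes F f f' :: "real \<Rightarrow> real"
  assumes F_deriv: "\<And>x. (F has_real_derivative f x) (at x)"
    and f_deriv: "\<And>x. (f has_real_derivative f' x) (at x)"
    and f_pos: "\<And>x. 0 < f x"
    and f_even: "\<And>x. f (- x) = f x"
    and f_log_concave: "strictly_concave (\<lambda>x. ln (f x))"
    and F_pos: "\<And>x. 0 < F x" and F_lt_1: "\<And>x. F x < 1"
    and F_bot: "(F \<longlongrightarrow> 0) at_bot" and F_top: "(F \<longlongrightarrow> 1) at_top"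
begin

lemma F_strict_mono: "x < y \<Longrightarrow> F x < F y"
  by (rule DERIV_pos_imp_increasing) (use F_deriv f_pos in blast)+

lemma F_mono: "x \<le> y \<Longrightarrow> F x \<le> F y"
  using F_strict_mono by (cases "x = y") (auto simp: less_imp_le)

lemma F_minus: "F (- x) = 1 - F x"
proof -
  let ?s = "\<lambda>x. F x + F (- x)"
  have "((\<lambda>x. F (- x)) has_real_derivative f (- x) * (- 1)) (at x)" for x
    by (rule DERIV_chain2[OF F_deriv]) (auto intro!: derivative_eq_intros)
  then have "(?s has_real_derivative f x + f (- x) * (- 1)) (at x)" for x
    by (intro DERIV_add F_deriv)
  then have "(?s has_real_derivative 0) (at x)" for x by (simp add: f_even)
  then have const: "?s y = ?s 0" for y using DERIV_isconst_all by blast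
  have "((\<lambda>x. F (- x)) \<longlongrightarrow> 0) at_top"
    by (rule filterlim_compose[OF F_bot filterlim_uminus_at_bot_at_top])
  then have lim: "(?s \<longlongrightarrow> 1 + 0) at_top" by (intro tendsto_add F_top)
  have "?s = (\<lambda>_. ?s 0)" by (rule ext) (rule const)
  with lim have "((\<lambda>_ :: real. ?s 0) \<longlongrightarrow> 1 + 0) at_top" by metis
  then have "?s 0 = 1" by (simp add: tendsto_const_iff)
  with const[of x] show ?thesis by simp
qed

lemma ln_f_strict:
  "x \<noteq> y \<Longrightarrow> 0 < t \<Longrightarrow> t < 1 \<Longrightarrow> (1 - t) * ln (f x) + t * ln (f y) < ln (f ((1 - t) * x + t * y))"
  using f_log_concave unfolding strictly_concave_def by blast

lemma f_le_f0: "f x \<le> f 0"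
proof (cases "x = 0")
  case False
  then have "(1 - 1 / 2) * ln (f x) + 1 / 2 * ln (f (- x)) < ln (f ((1 - 1 / 2) * x + 1 / 2 * (- x)))"
    by (intro ln_f_strict) auto
  then have "ln (f x) < ln (f 0)" by (simp add: f_even)
  then show ?thesis using f_pos by (simp add: less_imp_le)
qed simp

text \<open>
  \<open>ln f\<close> is strictly concave, so it lies strictly below its tangents; comparing the tangents at the
  two points gives the claim.
\<close>

lemma score_strict_decreasing:
  assumes "x < y"
  shows "f' y / f y < f' x / f x"
proof -
  let ?\<phi> = "\<lambda>x. ln (f x)"
  have deriv: "(?\<phi> has_real_derivative f' x / f x) (at x)" for x
    using f_pos[of x] by (auto intro!: derivative_eq_intros f_deriv simp: field_simps)
  have "convex_on UNIV (\<lambda>x. - ?\<phi> x)"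
  proof (rule convex_onI)
    fix t x y :: real assume "0 < t" "t < 1"
    then show "- ?\<phi> ((1 - t) *\<^sub>R x + t *\<^sub>R y) \<le> (1 - t) * - ?\<phi> x + t * - ?\<phi> y"
      using ln_f_strict[of x y t] by (cases "x = y") (auto simp: algebra_simps)
  qed simp
  then have tangent: "- (f' c / f c) * (x - c) \<le> - ?\<phi> x - (- ?\<phi> c)" for c x
    by (rule convex_on_imp_above_tangent) (auto intro!: derivative_intros deriv)
  \<comment> \<open>convexity gives the weak tangent inequality at the midpoint of \<open>c\<close> and \<open>z\<close>, and strict concavity makes it strict at \<open>z\<close>\<close>
  have strict_tangent: "?\<phi> z < ?\<phi> c + f' c / f c * (z - c)" if "z \<noteq> c" for c z
  proof -
    have "(1 - 1 / 2) * ?\<phi> c + 1 / 2 * ?\<phi> z < ?\<phi> ((1 - 1 / 2) * c + 1 / 2 * z)"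
      by (rule ln_f_strict) (use that in auto)
    moreover have "- (f' c / f c) * (((1 - 1 / 2) * c + 1 / 2 * z) - c) \<le>
        - ?\<phi> ((1 - 1 / 2) * c + 1 / 2 * z) - (- ?\<phi> c)" by (rule tangent)
    moreover have "((1 - 1 / 2) * c + 1 / 2 * z) - c = (z - c) / 2" by (simp add: field_simps)
    then have "- (f' c / f c) * (((1 - 1 / 2) * c + 1 / 2 * z) - c) = - (f' c / f c * (z - c)) / 2"
      by (simp only:)
    ultimately show ?thesis by simp
  qed
  define q r where qr: "q = f' y / f y" "r = f' x / f x"
  have "?\<phi> y < ?\<phi> x + r * (y - x)" "?\<phi> x < ?\<phi> y + q * (x - y)"
    using strict_tangent assms by (simp_all add: qr)
  then have "q * (y - x) < r * (y - x)" by (simp add: algebra_simps)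
  then have "q < r" using assms by (simp add: mult_less_cancel_right_disj)
  then show ?thesis by (simp only: qr)
qed

text \<open>
  For the score \<open>g = f' u / f u\<close> at \<open>u\<close>, the function \<open>f - g F\<close> is strictly increasing up to \<open>u\<close>, because
  the score is larger to the left. It is above \<open>- g F\<close>, which tends to 0 at \<open>- \<infinity>\<close>, so it is
  nonnegative to the left of \<open>u\<close> and its value at \<open>u\<close> is positive.
\<close>

lemma F_curvature: "F u * f' u < (f u)\<^sup>2"
proof -
  let ?g = "f' u / f u"
  let ?\<phi> = "\<lambda>w. f w - ?g * F w"
  have inc: "?\<phi> v < ?\<phi> w" if "v < w" "w \<le> u" for v w
  proof (rule DERIV_pos_imp_increasing_open[OF that(1)])
    fix z assume "v < z" "z < w"
    then have "?g < f' z / f z" using that by (intro score_strict_decreasing) simp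
    then have "0 < f' z - ?g * f z" using f_pos[of z] by (simp add: pos_less_divide_eq)
    moreover have "(?\<phi> has_real_derivative f' z - ?g * f z) (at z)"
      by (intro derivative_intros DERIV_cmult F_deriv f_deriv)
    ultimately show "\<exists>y. (?\<phi> has_real_derivative y) (at z) \<and> 0 < y" by blast
  next
    show "continuous_on {v..w} ?\<phi>"
      by (intro continuous_intros) (meson DERIV_isCont F_deriv f_deriv continuous_at_imp_continuous_on)+
  qed
  have "- ?g * F w \<le> ?\<phi> (u - 1)" if "w \<le> u - 2" for w
    using inc[of w "u - 1"] that f_pos[of w] by simp
  then have "eventually (\<lambda>w. - ?g * F w \<le> ?\<phi> (u - 1)) at_bot"
    unfolding eventually_at_bot_linorder by blast
  moreover have "((\<lambda>w. - ?g * F w) \<longlongrightarrow> - ?g * 0) at_bot" by (intro tendsto_intros F_bot)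
  ultimately have "- ?g * 0 \<le> ?\<phi> (u - 1)"
    by (intro tendsto_upperbound[of _ _ at_bot]) auto
  with inc[of "u - 1" u] have "?g * F u < f u" by simp
  then show ?thesis using f_pos[of u] by (simp add: field_simps power2_eq_square)
qed

text \<open>
  By Cauchy's mean value theorem \<open>f u - f w\<close> is \<open>F u - F w\<close> times the score at a point between \<open>w\<close> and
  \<open>u\<close>, hence lies strictly between \<open>F u - F w\<close> times the scores at the two ends. Inserting this bounds
  the left-hand side by the right-hand side minus \<open>f u * f w * (\<alpha> - \<beta>)\<^sup>2\<close>.
\<close>

lemma F_increment_curvature:
  assumes "w < u" and ab: "\<alpha> \<noteq> 0 \<or> \<beta> \<noteq> 0"
  shows "(F u - F w) * (\<alpha>\<^sup>2 * f' u - \<beta>\<^sup>2 * f' w) < (\<alpha> * f u - \<beta> * f w)\<^sup>2"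
proof -
  let ?s = "F u - F w"
  have s: "0 < ?s" using F_strict_mono[OF assms(1)] by simp
  have pos: "0 < f u" "0 < f w" by (rule f_pos)+
  obtain c where c: "w < c" "c < u" "(f u - f w) * f c = ?s * f' c"
    using GMVT'[of w u f F f f'] assms(1) F_deriv f_deriv DERIV_isCont by blast
  have mean: "f u - f w = ?s * (f' c / f c)" using c(3) f_pos[of c] by (simp add: field_simps)
  have "?s * (f' u / f u) < f u - f w" "f u - f w < ?s * (f' w / f w)"
    unfolding mean by (intro mult_strict_left_mono score_strict_decreasing c s)+
  then have up: "?s * f' u < (f u - f w) * f u" and low: "(f u - f w) * f w < ?s * f' w"
    using pos by (simp_all add: field_simps)
  have "?s * (\<alpha>\<^sup>2 * f' u - \<beta>\<^sup>2 * f' w) = \<alpha>\<^sup>2 * (?s * f' u) - \<beta>\<^sup>2 * (?s * f' w)"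
    by (simp add: algebra_simps)
  also have "\<dots> < \<alpha>\<^sup>2 * ((f u - f w) * f u) - \<beta>\<^sup>2 * ((f u - f w) * f w)"
  proof (cases "\<alpha> = 0")
    case True
    with ab have "0 < \<beta>\<^sup>2" by simp
    with low True show ?thesis by simp
  next
    case False
    then have "\<alpha>\<^sup>2 * (?s * f' u) < \<alpha>\<^sup>2 * ((f u - f w) * f u)" using up by simp
    moreover have "\<beta>\<^sup>2 * ((f u - f w) * f w) \<le> \<beta>\<^sup>2 * (?s * f' w)"
      using low by (intro mult_left_mono) auto
    ultimately show ?thesis by linarith
  qed
  also have "\<dots> = (\<alpha> * f u - \<beta> * f w)\<^sup>2 - f u * f w * (\<alpha> - \<beta>)\<^sup>2"
    by (simp add: algebra_simps power2_eq_square)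
  also have "\<dots> \<le> (\<alpha> * f u - \<beta> * f w)\<^sup>2" using pos by simp
  finally show ?thesis .
qed

lemma F_affine_deriv:
  "((\<lambda>t. F (a + t * b)) has_real_derivative b * f (a + t * b)) (at t)"
  "((\<lambda>t. f (a + t * b)) has_real_derivative b * f' (a + t * b)) (at t)"
proof -
  have "((\<lambda>t. a + t * b) has_real_derivative b) (at t)" by (auto intro!: derivative_eq_intros)
  from DERIV_chain2[OF F_deriv this] DERIV_chain2[OF f_deriv this]
  show "((\<lambda>t. F (a + t * b)) has_real_derivative b * f (a + t * b)) (at t)"
    "((\<lambda>t. f (a + t * b)) has_real_derivative b * f' (a + t * b)) (at t)"
    by (simp_all add: mult.commute)
qed

lemma F_midpoint:
  assumes "x \<noteq> y"
  shows "F x * F y < (F ((x + y) / 2))\<^sup>2"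
proof -
  let ?b = "y - x"
  let ?l = "\<lambda>t. x + t * ?b"
  have "F (?l 0) * F (?l 1) < (F (?l (1 / 2)))\<^sup>2"
  proof (rule strict_log_midpoint[where ?h1.0 = "\<lambda>t. ?b * f (?l t)" and ?h2.0 = "\<lambda>t. ?b * (?b * f' (?l t))"])
    fix t
    have "?b\<^sup>2 * (F (?l t) * f' (?l t)) < ?b\<^sup>2 * (f (?l t))\<^sup>2"
      using F_curvature assms by simp
    then show "F (?l t) * (?b * (?b * f' (?l t))) < (?b * f (?l t))\<^sup>2"
      by (simp add: power2_eq_square mult_ac)
  qed (auto intro: F_affine_deriv DERIV_cmult F_pos)
  moreover have "?l 0 = x" "?l 1 = y" "?l (1 / 2) = (x + y) / 2" by (simp_all add: field_simps)
  ultimately show ?thesis by metis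
qed

text \<open>
  Strict log-concavity of the increment \<open>F u - F w\<close> jointly in its end points: the two pairs are joined
  by a segment, along which \<open>w < u\<close> persists, and the curvature of the increment has the right sign.
\<close>

lemma F_increment_midpoint:
  assumes "w < u" "w' < u'" "(u, w) \<noteq> (u', w')"
  shows "(F u - F w) * (F u' - F w') < (F ((u + u') / 2) - F ((w + w') / 2))\<^sup>2"
proof -
  let ?\<alpha> = "u' - u" and ?\<beta> = "w' - w"
  let ?u = "\<lambda>t. u + t * ?\<alpha>" and ?w = "\<lambda>t. w + t * ?\<beta>"
  have wu: "?w t < ?u t" if "0 \<le> t" "t \<le> 1" for t
  proof -
    have "?u t - ?w t = (1 - t) * (u - w) + t * (u' - w')" by (simp add: algebra_simps)
    moreover have "0 < (1 - t) * (u - w) + t * (u' - w')"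
    proof (cases "t = 1")
      case False
      with that assms show ?thesis by (intro add_pos_nonneg mult_pos_pos mult_nonneg_nonneg) auto
    qed (use assms in simp)
    ultimately show ?thesis by linarith
  qed
  have "(F (?u 0) - F (?w 0)) * (F (?u 1) - F (?w 1)) < (F (?u (1 / 2)) - F (?w (1 / 2)))\<^sup>2"
  proof (rule strict_log_midpoint[where h = "\<lambda>t. F (?u t) - F (?w t)"
        and ?h1.0 = "\<lambda>t. ?\<alpha> * f (?u t) - ?\<beta> * f (?w t)"
        and ?h2.0 = "\<lambda>t. ?\<alpha> * (?\<alpha> * f' (?u t)) - ?\<beta> * (?\<beta> * f' (?w t))"])
    fix t :: real assume t: "0 \<le> t" "t \<le> 1"
    show "0 < F (?u t) - F (?w t)" using F_strict_mono[OF wu[OF t]] by simp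
    have "?\<alpha> \<noteq> 0 \<or> ?\<beta> \<noteq> 0" using assms(3) by auto
    from F_increment_curvature[OF wu[OF t] this]
    show "(F (?u t) - F (?w t)) * (?\<alpha> * (?\<alpha> * f' (?u t)) - ?\<beta> * (?\<beta> * f' (?w t)))
        < (?\<alpha> * f (?u t) - ?\<beta> * f (?w t))\<^sup>2"
      by (simp only: power2_eq_square mult.assoc)
  qed (intro DERIV_diff DERIV_cmult F_affine_deriv)+
  moreover have "?u 0 = u" "?w 0 = w" "?u 1 = u'" "?w 1 = w'"
    "?u (1 / 2) = (u + u') / 2" "?w (1 / 2) = (w + w') / 2" by (simp_all add: field_simps)
  ultimately show ?thesis by metis
qed

section \<open>The Thurstone model\<close>

text \<open>
  By symmetry of \<open>f\<close>, the probability \<open>1 - F (d - x)\<close> of `better' is written as \<open>F (x - d)\<close>.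
\<close>

definition thurstone :: "edge_kind \<Rightarrow> real \<Rightarrow> real \<Rightarrow> real" where
  "thurstone k x d = (case k of Better \<Rightarrow> F (x - d) | Equal \<Rightarrow> F (d - x) - F (- d - x))"

lemma F_bounded_below: "0 < \<epsilon> \<Longrightarrow> \<exists>c. \<forall>y. \<epsilon> \<le> F y \<longrightarrow> - c \<le> y"
proof -
  assume "0 < \<epsilon>"
  then have "eventually (\<lambda>y. F y < \<epsilon>) at_bot" using order_tendstoD(2)[OF F_bot] by blast
  then obtain N where "\<And>y. y \<le> N \<Longrightarrow> F y < \<epsilon>" unfolding eventually_at_bot_linorder by blast
  then have "\<forall>y. \<epsilon> \<le> F y \<longrightarrow> - (- N) \<le> y" by (metis add.inverse_inverse linear not_le)
  then show ?thesis by blast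
qed

text \<open>
  The density of a symmetric log-concave distribution is largest at 0, so an interval of length \<open>2 * d\<close>
  carries probability at most \<open>2 * d * f 0\<close>.
\<close>

lemma thurstone_Equal_lower:
  assumes "\<epsilon> \<le> thurstone Equal x d" "0 < d"
  shows "\<epsilon> / (2 * f 0) \<le> d"
proof -
  obtain z where z: "F (d - x) - F (- d - x) = ((d - x) - (- d - x)) * f z"
    using MVT2[of "- d - x" "d - x" F f] F_deriv assms(2) by auto
  have "\<epsilon> \<le> 2 * d * f z" using z assms(1) by (simp add: thurstone_def)
  also have "\<dots> \<le> 2 * d * f 0" using f_le_f0 assms(2) by (intro mult_left_mono) auto
  finally show ?thesis using f_pos[of 0] by (simp add: field_simps)
qed

lemma comparison_model_thurstone: "comparison_model {0<..} thurstone"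
proof
  show "{0<..} \<noteq> ({} :: real set)" using greaterThan_non_empty by blast
next
  fix d :: real assume "d \<in> {0<..}"
  then show "\<exists>e\<in>{0<..}. e < d" using dense by fastforce
next
  fix d :: real and k x assume d: "d \<in> {0<..}"
  then show "0 < thurstone k x d"
    using F_strict_mono[of "- d - x" "d - x"] F_pos by (cases k) (auto simp: thurstone_def)
  show "thurstone k x d \<le> 1"
    using F_lt_1[of "x - d"] F_lt_1[of "d - x"] F_pos[of "- d - x"] by (cases k) (auto simp: thurstone_def)
next
  fix k
  have F: "continuous_on UNIV F" by (meson DERIV_isCont F_deriv continuous_at_imp_continuous_on)
  show "continuous_on (UNIV \<times> {0<..}) (\<lambda>(x, d). thurstone k x d)"
    by (cases k) (auto simp: thurstone_def split_def intro!: continuous_intros continuous_on_compose2[OF F])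
next
  fix d e x y :: real assume "d \<in> {0<..}" "e \<in> {0<..}" "x \<le> y" "e - d \<le> y - x"
  then show "thurstone Better x d \<le> thurstone Better y e"
    by (auto simp: thurstone_def intro!: F_mono)
next
  fix d e x y :: real assume "d \<in> {0<..}" "e \<in> {0<..}" "\<bar>y - x\<bar> \<le> e - d"
  then show "thurstone Equal x d \<le> thurstone Equal y e"
    unfolding thurstone_def edge_kind.case by (intro diff_mono[OF F_mono F_mono]) linarith+
next
  fix \<epsilon> :: real and k assume "0 < \<epsilon>"
  then obtain c where c: "\<And>y. \<epsilon> \<le> F y \<Longrightarrow> - c \<le> y" using F_bounded_below by blast
  have "gain k * d - c \<le> x" if "\<epsilon> \<le> thurstone k x d" for x d
  proof (cases k)
    case Better
    then show ?thesis using c[of "x - d"] that by (simp add: thurstone_def)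
  next
    case Equal
    have "F (- d - x) = 1 - F (d + x)" using F_minus[of "d + x"] by simp
    then have "\<epsilon> \<le> F (d + x)" using Equal that F_lt_1[of "d - x"] by (simp add: thurstone_def)
    then show ?thesis using c[of "d + x"] Equal by simp
  qed
  then show "\<exists>c. \<forall>x. \<forall>d\<in>{0<..}. \<epsilon> \<le> thurstone k x d \<longrightarrow> gain k * d - c \<le> x" by blast
next
  fix \<epsilon> :: real assume "0 < \<epsilon>"
  then have "\<epsilon> / (2 * f 0) \<in> {0<..}" using f_pos by simp
  then show "\<exists>e\<in>{0<..}. \<forall>x. \<forall>d\<in>{0<..}. \<epsilon> \<le> thurstone Equal x d \<longrightarrow> e \<le> d"
    using thurstone_Equal_lower by (intro bexI[of _ "\<epsilon> / (2 * f 0)"]) auto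
next
  fix d e x y :: real assume de: "d \<in> {0<..}" "e \<in> {0<..}"
  have mid: "(x + y) / 2 - (d + e) / 2 = ((x - d) + (y - e)) / 2"
    "(d + e) / 2 - (x + y) / 2 = ((d - x) + (e - y)) / 2"
    "- ((d + e) / 2) - (x + y) / 2 = ((- d - x) + (- e - y)) / 2"
    by (simp_all add: field_simps)
  show B: "thurstone Better x d * thurstone Better y e < (thurstone Better ((x + y) / 2) ((d + e) / 2))\<^sup>2"
    if "x - d \<noteq> y - e"
    unfolding thurstone_def edge_kind.case mid using that by (rule F_midpoint)
  show E: "thurstone Equal x d * thurstone Equal y e < (thurstone Equal ((x + y) / 2) ((d + e) / 2))\<^sup>2"
    if "(x, d) \<noteq> (y, e)"
    unfolding thurstone_def edge_kind.case mid
    by (rule F_increment_midpoint) (use de that in auto)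
  show "thurstone k x d * thurstone k y e \<le> (thurstone k ((x + y) / 2) ((d + e) / 2))\<^sup>2" for k
  proof (cases k)
    case Better
    show ?thesis
    proof (cases "x - d = y - e")
      case True
      have half: "(y - e + (y - e)) / 2 = y - e" by (simp add: field_simps)
      show ?thesis unfolding Better thurstone_def edge_kind.case mid True half
        by (simp add: power2_eq_square)
    next
      case False
      then show ?thesis using B Better by (simp add: less_imp_le)
    qed
  next
    case Equal
    show ?thesis
    proof (cases "(x, d) = (y, e)")
      case True
      then show ?thesis by (simp add: power2_eq_square)
    next
      case False
      then show ?thesis using E Equal by (simp add: less_imp_le)
    qed
  qed
qed auto

end

lemma class_F_log_concave_distribution:
  assumes "F \<in> class_F"
  shows "log_concave_distribution F (deriv F) (deriv (deriv F))"
proof -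
  obtain M where M: "real_distribution M" "F = cdf M" using assms by (auto simp: class_F_def)
  interpret real_distribution M by (rule M)
  have diff: "(deriv ^^ k) F differentiable (at x)" if "k < 3" for k x
    using assms that by (auto simp: class_F_def C3_def)
  have "F differentiable (at x)" "deriv F differentiable (at x)" for x
    using diff[of 0] diff[of 1] by auto
  then have "(F has_real_derivative deriv F x) (at x)"
    "(deriv F has_real_derivative deriv (deriv F) x) (at x)" for x
    by (simp_all add: DERIV_deriv_iff_real_differentiable)
  then show ?thesis
    using assms cdf_lim_at_bot cdf_lim_at_top_prob
    by unfold_locales (auto simp: class_F_def M(2))
qed

lemma thurstone_unique_maximizer_iff:
  assumes F: "F \<in> class_F" and data: "data_matrix n A" and n: "1 \<le> n"
  shows "(\<exists>!\<theta>. is_arg_max (loglik_THMM3 F n A) (\<lambda>\<theta>. \<theta> \<in> params_THMM3 n) \<theta>)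
    \<longleftrightarrow> A_NS n A \<and> B_NS n A \<and> C_NS n A"
proof -
  interpret log_concave_distribution F "deriv F" "deriv (deriv F)"
    by (rule class_F_log_concave_distribution[OF F])
  interpret model: comparison_model "{0<..}" thurstone by (rule comparison_model_thurstone)
  have "model.params n = params_THMM3 n" by (auto simp: model.params_def params_THMM3_def)
  moreover have "loglik_THMM3 F n A \<theta> = model.loglik n A \<theta>" for \<theta>
  proof -
    obtain m d where th: "\<theta> = (m, d)" by fastforce
    show ?thesis
      unfolding th loglik_THMM3_def model.loglik_def split_conv
    proof (rule log_likelihood_eq_edge_sum[OF data])
      fix i j
      show "prob_THMM3 F m d i j 1 = thurstone Better (m j - m i) d"
        by (simp add: prob_THMM3_def thurstone_def algebra_simps)
      show "prob_THMM3 F m d i j 2 = thurstone Equal (m i - m j) d"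
        by (simp add: prob_THMM3_def thurstone_def)
      show "prob_THMM3 F m d i j 3 = thurstone Better (m i - m j) d"
        using F_minus[of "d - (m i - m j)"] by (simp add: prob_THMM3_def thurstone_def algebra_simps)
      show "thurstone Equal (m i - m j) d = thurstone Equal (m j - m i) d"
        using F_minus[of "d - (m i - m j)"] F_minus[of "d + (m i - m j)"]
        by (simp add: thurstone_def algebra_simps)
    qed
  qed
  ultimately show ?thesis using model.unique_maximizer_iff[OF data n] by (simp add: is_arg_max_def)
qed

section \<open>The Davidson model\<close>

text \<open>
  The Cauchy-Schwarz inequality for the vectors \<open>(1, exp (a / 2), exp (b / 2))\<close> and
  \<open>(1, exp (a' / 2), exp (b' / 2))\<close>; because of the common first entry they are parallel only if they
  are equal. The difference of the two sides is Lagrange's sum of squares.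
\<close>

lemma exp_trinomial_midpoint:
  fixes a b a' b' :: real
  shows "(1 + exp ((a + a') / 2) + exp ((b + b') / 2))\<^sup>2 \<le> (1 + exp a + exp b) * (1 + exp a' + exp b')"
    and "(a, b) \<noteq> (a', b') \<Longrightarrow>
      (1 + exp ((a + a') / 2) + exp ((b + b') / 2))\<^sup>2 < (1 + exp a + exp b) * (1 + exp a' + exp b')"
proof -
  define x y x' y' where xy: "x = exp (a / 2)" "y = exp (b / 2)" "x' = exp (a' / 2)" "y' = exp (b' / 2)"
  have e: "exp ((a + a') / 2) = x * x'" "exp ((b + b') / 2) = y * y'"
    "exp a = x\<^sup>2" "exp b = y\<^sup>2" "exp a' = x'\<^sup>2" "exp b' = y'\<^sup>2"
    by (simp_all add: xy exp_add[symmetric] power2_eq_square add_divide_distrib)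
  have id: "(1 + exp a + exp b) * (1 + exp a' + exp b') - (1 + exp ((a + a') / 2) + exp ((b + b') / 2))\<^sup>2 =
      (x - x')\<^sup>2 + (y - y')\<^sup>2 + (x * y' - x' * y)\<^sup>2"
    unfolding e by (simp add: algebra_simps power2_eq_square)
  have "0 \<le> (x - x')\<^sup>2 + (y - y')\<^sup>2 + (x * y' - x' * y)\<^sup>2" by simp
  with id show "(1 + exp ((a + a') / 2) + exp ((b + b') / 2))\<^sup>2 \<le> (1 + exp a + exp b) * (1 + exp a' + exp b')"
    by linarith
  assume "(a, b) \<noteq> (a', b')"
  then have "x \<noteq> x' \<or> y \<noteq> y'" by (auto simp: xy)
  then have "0 < (x - x')\<^sup>2 + (y - y')\<^sup>2 + (x * y' - x' * y)\<^sup>2"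
    by (auto simp: add_pos_nonneg add_nonneg_pos)
  with id show "(1 + exp ((a + a') / 2) + exp ((b + b') / 2))\<^sup>2 < (1 + exp a + exp b) * (1 + exp a' + exp b')"
    by linarith
qed

text \<open>
  Davidson's probabilities in the coordinates \<open>x = (ln \<pi>\<^sub>i - ln \<pi>\<^sub>j) / 2\<close> and \<open>d = ln \<nu>\<close>, in which they are
  reciprocals of sums of exponentials of linear functions.
\<close>

definition davidson :: "edge_kind \<Rightarrow> real \<Rightarrow> real \<Rightarrow> real" where
  "davidson k x d = (case k of Better \<Rightarrow> 1 / (1 + exp (- 2 * x) + exp (d - x))
     | Equal \<Rightarrow> 1 / (1 + exp (x - d) + exp (- x - d)))"

lemma inverse_exp_trinomial_bound:
  fixes \<epsilon> a b :: real
  assumes "0 < \<epsilon>" "\<epsilon> \<le> 1 / (1 + exp a + exp b)"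
  shows "a \<le> - ln \<epsilon>" "b \<le> - ln \<epsilon>"
proof -
  have pos: "0 < 1 + exp a + exp b" by (simp add: add_pos_pos)
  have "1 + exp a + exp b \<le> 1 / \<epsilon>" using assms pos by (simp add: field_simps)
  then have "exp a \<le> 1 / \<epsilon>" "exp b \<le> 1 / \<epsilon>" using exp_gt_zero[of a] exp_gt_zero[of b] by linarith+
  then have "a \<le> ln (1 / \<epsilon>)" "b \<le> ln (1 / \<epsilon>)" using assms(1) by (simp_all add: ln_ge_iff)
  then show "a \<le> - ln \<epsilon>" "b \<le> - ln \<epsilon>" using assms(1) by (simp_all add: ln_div)
qed

lemma comparison_model_davidson: "comparison_model UNIV davidson"
proof
  fix d :: real
  show "\<exists>e\<in>UNIV. e < d" by (intro bexI[of _ "d - 1"]) auto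
next
  fix d x :: real and k
  have s: "0 < 1 + exp a + exp b" for a b :: real by (simp add: add_pos_pos)
  then show "0 < davidson k x d" by (cases k) (auto simp: davidson_def)
  show "davidson k x d \<le> 1" using s by (cases k) (auto simp: davidson_def divide_le_eq_1)
next
  fix k
  have "1 + exp a + exp b \<noteq> 0" for a b :: real
    using exp_gt_zero[of a] exp_gt_zero[of b] by linarith
  then show "continuous_on (UNIV \<times> UNIV) (\<lambda>(x, d). davidson k x d)"
    by (cases k) (auto simp: davidson_def split_def intro!: continuous_intros)
next
  fix d e x y :: real assume "x \<le> y" "e - d \<le> y - x"
  then show "davidson Better x d \<le> davidson Better y e"
    by (auto simp: davidson_def intro!: divide_left_mono add_mono add_pos_pos mult_pos_pos)
next
  fix d e x y :: real assume "\<bar>y - x\<bar> \<le> e - d"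
  then show "davidson Equal x d \<le> davidson Equal y e"
    by (auto simp: davidson_def intro!: divide_left_mono add_mono add_pos_pos mult_pos_pos)
next
  fix \<epsilon> :: real and k assume eps: "0 < \<epsilon>"
  have "gain k * d - (- ln \<epsilon>) \<le> x" if "\<epsilon> \<le> davidson k x d" for x d
    using inverse_exp_trinomial_bound[OF eps] that by (cases k) (fastforce simp: davidson_def)+
  then show "\<exists>c. \<forall>x. \<forall>d\<in>UNIV. \<epsilon> \<le> davidson k x d \<longrightarrow> gain k * d - c \<le> x" by blast
next
  fix \<epsilon> :: real assume eps: "0 < \<epsilon>"
  have "ln \<epsilon> \<le> d" if "\<epsilon> \<le> davidson Equal x d" for x d
    using inverse_exp_trinomial_bound[OF eps, of "x - d" "- x - d"] that by (simp add: davidson_def)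
  then show "\<exists>e\<in>UNIV. \<forall>x. \<forall>d\<in>UNIV. \<epsilon> \<le> davidson Equal x d \<longrightarrow> e \<le> d" by blast
next
  fix d e x y :: real
  have mid: "- 2 * ((x + y) / 2) = (- 2 * x + - 2 * y) / 2"
    "(d + e) / 2 - (x + y) / 2 = ((d - x) + (e - y)) / 2"
    "(x + y) / 2 - (d + e) / 2 = ((x - d) + (y - e)) / 2"
    "- ((x + y) / 2) - (d + e) / 2 = ((- x - d) + (- y - e)) / 2"
    by (simp_all add: field_simps)
  have pos: "0 < 1 + exp a + exp b" for a b :: real by (simp add: add_pos_pos)
  have le: "1 / u * (1 / v) \<le> (1 / w)\<^sup>2" if "w\<^sup>2 \<le> u * v" "0 < u" "0 < v" "0 < w" for u v w :: real
  proof -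
    have "1 / (u * v) \<le> 1 / w\<^sup>2" using that by (intro divide_left_mono) auto
    then show ?thesis by (simp add: power_divide)
  qed
  have lt: "1 / u * (1 / v) < (1 / w)\<^sup>2" if "w\<^sup>2 < u * v" "0 < u" "0 < v" "0 < w" for u v w :: real
  proof -
    have "1 / (u * v) < 1 / w\<^sup>2" using that by (intro divide_strict_left_mono) auto
    then show ?thesis by (simp add: power_divide)
  qed
  show "davidson k x d * davidson k y e \<le> (davidson k ((x + y) / 2) ((d + e) / 2))\<^sup>2" for k
    by (cases k; simp only: davidson_def edge_kind.case mid) (intro le exp_trinomial_midpoint(1) pos)+
  show "davidson Better x d * davidson Better y e < (davidson Better ((x + y) / 2) ((d + e) / 2))\<^sup>2"
    if "x - d \<noteq> y - e"
    unfolding davidson_def edge_kind.case mid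
    by (intro lt exp_trinomial_midpoint(2) pos) (use that in auto)
  show "davidson Equal x d * davidson Equal y e < (davidson Equal ((x + y) / 2) ((d + e) / 2))\<^sup>2"
    if "(x, d) \<noteq> (y, e)"
    unfolding davidson_def edge_kind.case mid
    by (intro lt exp_trinomial_midpoint(2) pos) (use that in auto)
qed auto

lemma davidson_eq_ratio:
  assumes "0 < a" "0 < b" "0 < \<nu>"
  shows "davidson Better ((ln a - ln b) / 2) (ln \<nu>) = a / (a + b + \<nu> * sqrt (a * b))"
    and "davidson Equal ((ln a - ln b) / 2) (ln \<nu>) = \<nu> * sqrt (a * b) / (a + b + \<nu> * sqrt (a * b))"
proof -
  define r s where rs: "r = sqrt a" "s = sqrt b"
  have pos: "0 < r" "0 < s" using assms by (simp_all add: rs)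
  have ab: "a = r * r" "b = s * s" "sqrt (a * b) = r * s"
    using assms by (simp_all add: rs real_sqrt_mult)
  define y where "y = ln r - ln s"
  have x: "(ln a - ln b) / 2 = y" using assms by (simp add: y_def rs ln_sqrt diff_divide_distrib)
  have y: "exp y = r / s" "exp (- y) = s / r"
    using pos by (simp_all add: y_def exp_diff)
  have "exp (- 2 * y) = exp (- y) * exp (- y)" by (simp only: exp_add[symmetric]) simp
  moreover have "exp (ln \<nu> - y) = \<nu> * exp (- y)"
    using assms(3) by (simp add: exp_diff exp_minus divide_inverse)
  moreover have "exp (y - ln \<nu>) = exp y / \<nu>" "exp (- y - ln \<nu>) = exp (- y) / \<nu>"
    using assms(3) by (simp_all only: exp_diff) simp_all
  ultimately have e: "exp (- 2 * y) = (s / r) * (s / r)" "exp (ln \<nu> - y) = \<nu> * (s / r)"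
    "exp (y - ln \<nu>) = r / s / \<nu>" "exp (- y - ln \<nu>) = s / r / \<nu>"
    by (simp_all only: y)
  have D: "0 < r * r + s * s + \<nu> * (r * s)" using pos assms by (simp add: add_pos_pos)
  show "davidson Better ((ln a - ln b) / 2) (ln \<nu>) = a / (a + b + \<nu> * sqrt (a * b))"
    unfolding davidson_def edge_kind.case x e unfolding ab(3) unfolding ab(1,2) using pos D by (simp add: field_simps)
  show "davidson Equal ((ln a - ln b) / 2) (ln \<nu>) = \<nu> * sqrt (a * b) / (a + b + \<nu> * sqrt (a * b))"
    unfolding davidson_def edge_kind.case x e unfolding ab(3) unfolding ab(1,2) using pos D assms(3) by (simp add: field_simps)
qed

lemma unique_arg_max_bij_betw:
  fixes f :: "'a \<Rightarrow> 'c :: linorder"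
  assumes h: "bij_betw h P Q" and eq: "\<And>x. x \<in> P \<Longrightarrow> f x = g (h x)"
  shows "(\<exists>!x. is_arg_max f (\<lambda>x. x \<in> P) x) \<longleftrightarrow> (\<exists>!y. is_arg_max g (\<lambda>y. y \<in> Q) y)"
proof -
  have Q: "Q = h ` P" and inj: "inj_on h P" using h by (auto simp: bij_betw_def)
  have iff: "is_arg_max f (\<lambda>x. x \<in> P) x \<longleftrightarrow> is_arg_max g (\<lambda>y. y \<in> Q) (h x)" if "x \<in> P" for x
    using that eq by (auto simp: is_arg_max_linorder Q)
  have "is_arg_max f (\<lambda>x. x \<in> P) x \<Longrightarrow> x \<in> P" "is_arg_max g (\<lambda>y. y \<in> Q) y \<Longrightarrow> y \<in> h ` P" for x y
    by (auto simp: is_arg_max_def Q)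
  with iff inj show ?thesis
    unfolding Ex1_def inj_on_def by (smt (verit, ccfv_threshold) image_iff)
qed

text \<open>
  The likelihood depends only on the ratios of the \<open>\<pi> i\<close>. The simplex normalization and the
  normalization \<open>m 1 = 0\<close> each pick one representative of every class of proportional vectors. The
  inverse is a softmax.
\<close>

lemma bij_betw_log_ratio:
  assumes n: "1 \<le> n"
  shows "bij_betw (\<lambda>(\<pi>, \<nu>). (\<lambda>i\<in>{1..n}. (ln (\<pi> i) - ln (\<pi> 1)) / 2, ln \<nu>))
    (params_D3 n) (comparison_model.params UNIV n)"
proof -
  interpret comparison_model UNIV davidson by (rule comparison_model_davidson)
  let ?Z = "\<lambda>m. \<Sum>j=1..n. exp (2 * m j)"
  have Z: "0 < ?Z m" for m :: "nat \<Rightarrow> real" using n by (intro sum_pos) auto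
  show ?thesis
  proof (rule bij_betw_byWitness[where f' = "\<lambda>(m, d). (\<lambda>i\<in>{1..n}. exp (2 * m i) / ?Z m, exp d)"])
    show "\<forall>\<theta>\<in>params_D3 n. (case case \<theta> of (\<pi>, \<nu>) \<Rightarrow> (\<lambda>i\<in>{1..n}. (ln (\<pi> i) - ln (\<pi> 1)) / 2, ln \<nu>) of
        (m, d) \<Rightarrow> (\<lambda>i\<in>{1..n}. exp (2 * m i) / ?Z m, exp d)) = \<theta>"
    proof
      fix \<theta> assume mem: "\<theta> \<in> params_D3 n"
      obtain \<pi> \<nu> where th: "\<theta> = (\<pi>, \<nu>)" by fastforce
      have pi: "\<pi> \<in> {1..n} \<rightarrow>\<^sub>E UNIV" "\<And>i. i \<in> {1..n} \<Longrightarrow> 0 < \<pi> i" "(\<Sum>i=1..n. \<pi> i) = 1" "0 < \<nu>"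
        using mem by (auto simp: th params_D3_def)
      let ?m = "\<lambda>i\<in>{1..n}. (ln (\<pi> i) - ln (\<pi> 1)) / 2"
      have e: "exp (2 * ?m i) = \<pi> i / \<pi> 1" if "i \<in> {1..n}" for i
      proof -
        have "2 * ?m i = ln (\<pi> i) - ln (\<pi> 1)" using that by simp
        then show ?thesis using pi(2)[OF that] pi(2)[of 1] n by (simp only: exp_diff) simp
      qed
      have "?Z ?m = (\<Sum>j=1..n. \<pi> j / \<pi> 1)" by (intro sum.cong refl e)
      also have "\<dots> = 1 / \<pi> 1" by (simp add: sum_divide_distrib[symmetric] pi(3)[simplified])
      finally have "exp (2 * ?m i) / ?Z ?m = \<pi> i" if "i \<in> {1..n}" for i
        using e[OF that] pi(2)[of 1] n by simp
      then have "(\<lambda>i\<in>{1..n}. exp (2 * ?m i) / ?Z ?m) = \<pi>"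
        using pi(1) by (intro ext) (auto simp: restrict_def)
      then show "(case case \<theta> of (\<pi>, \<nu>) \<Rightarrow> (\<lambda>i\<in>{1..n}. (ln (\<pi> i) - ln (\<pi> 1)) / 2, ln \<nu>) of
        (m, d) \<Rightarrow> (\<lambda>i\<in>{1..n}. exp (2 * m i) / ?Z m, exp d)) = \<theta>"
        unfolding th split_conv using pi(4) by simp
    qed
    show "\<forall>\<theta>\<in>params n. (case case \<theta> of (m, d) \<Rightarrow> (\<lambda>i\<in>{1..n}. exp (2 * m i) / ?Z m, exp d) of
        (\<pi>, \<nu>) \<Rightarrow> (\<lambda>i\<in>{1..n}. (ln (\<pi> i) - ln (\<pi> 1)) / 2, ln \<nu>)) = \<theta>"
    proof
      fix \<theta> assume "\<theta> \<in> params n"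
      then obtain m d where th: "\<theta> = (m, d)" "m \<in> {1..n} \<rightarrow>\<^sub>E UNIV" "m 1 = 0" by (auto simp: params_def)
      have "ln (1 / ?Z m) = - ln (?Z m)" using Z[of m] by (subst ln_div) auto
      moreover have "ln (exp (2 * m i) / ?Z m) = 2 * m i - ln (?Z m)" for i using Z[of m] by (subst ln_div) auto
      ultimately have "(\<lambda>i\<in>{1..n}. (ln ((\<lambda>i\<in>{1..n}. exp (2 * m i) / ?Z m) i) -
          ln ((\<lambda>i\<in>{1..n}. exp (2 * m i) / ?Z m) 1)) / 2) = m"
        using th(2,3) n by (intro ext) (auto simp: restrict_def)
      then show "(case case \<theta> of (m, d) \<Rightarrow> (\<lambda>i\<in>{1..n}. exp (2 * m i) / ?Z m, exp d) of
        (\<pi>, \<nu>) \<Rightarrow> (\<lambda>i\<in>{1..n}. (ln (\<pi> i) - ln (\<pi> 1)) / 2, ln \<nu>)) = \<theta>"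
        unfolding th(1) split_conv by simp
    qed
    show "(\<lambda>(\<pi>, \<nu>). (\<lambda>i\<in>{1..n}. (ln (\<pi> i) - ln (\<pi> 1)) / 2, ln \<nu>)) ` params_D3 n \<subseteq> params n"
      using n by (auto simp: params_D3_def params_def)
    have "(\<Sum>i=1..n. exp (2 * m i) / ?Z m) = 1" for m :: "nat \<Rightarrow> real"
      using Z[of m] by (simp add: sum_divide_distrib[symmetric])
    then show "(\<lambda>(m, d). (\<lambda>i\<in>{1..n}. exp (2 * m i) / ?Z m, exp d)) ` params n \<subseteq> params_D3 n"
      using Z by (auto simp: params_D3_def params_def)
  qed
qed

lemma davidson_unique_maximizer_iff:
  assumes data: "data_matrix n A" and n: "1 \<le> n"
  shows "(\<exists>!\<theta>. is_arg_max (loglik_D3 n A) (\<lambda>\<theta>. \<theta> \<in> params_D3 n) \<theta>)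
    \<longleftrightarrow> A_NS n A \<and> B_NS n A \<and> C_NS n A"
proof -
  interpret comparison_model UNIV davidson by (rule comparison_model_davidson)
  let ?h = "\<lambda>(\<pi>, \<nu>). (\<lambda>i\<in>{1..n}. (ln (\<pi> i) - ln (\<pi> 1)) / 2, ln \<nu>) :: (nat \<Rightarrow> real) \<times> real"
  have "loglik_D3 n A \<theta> = loglik n A (?h \<theta>)" if "\<theta> \<in> params_D3 n" for \<theta>
  proof -
    obtain \<pi> \<nu> where th: "\<theta> = (\<pi>, \<nu>)" by fastforce
    have pi: "0 < \<nu>" "\<And>i. i \<in> {1..n} \<Longrightarrow> 0 < \<pi> i" using that by (auto simp: th params_D3_def)
    let ?m = "\<lambda>i\<in>{1..n}. (ln (\<pi> i) - ln (\<pi> 1)) / 2"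
    have x: "?m i - ?m j = (ln (\<pi> i) - ln (\<pi> j)) / 2" if "i \<in> {1..n}" "j \<in> {1..n}" for i j
      using that by (simp add: field_simps)
    show ?thesis
      unfolding th loglik_D3_def loglik_def split_conv
    proof (rule log_likelihood_eq_edge_sum[OF data])
      fix i j assume ij: "i \<in> {1..n}" "j \<in> {1..n}"
      show "prob_D3 \<pi> \<nu> i j 1 = davidson Better (?m j - ?m i) (ln \<nu>)"
        unfolding x[OF ij(2,1)] using davidson_eq_ratio[of "\<pi> j" "\<pi> i" \<nu>] pi ij
        by (simp add: prob_D3_def add_ac mult_ac)
      show "prob_D3 \<pi> \<nu> i j 2 = davidson Equal (?m i - ?m j) (ln \<nu>)"
        unfolding x[OF ij] using davidson_eq_ratio[of "\<pi> i" "\<pi> j" \<nu>] pi ij by (simp add: prob_D3_def)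
      show "prob_D3 \<pi> \<nu> i j 3 = davidson Better (?m i - ?m j) (ln \<nu>)"
        unfolding x[OF ij] using davidson_eq_ratio[of "\<pi> i" "\<pi> j" \<nu>] pi ij by (simp add: prob_D3_def)
      show "davidson Equal (?m i - ?m j) (ln \<nu>) = davidson Equal (?m j - ?m i) (ln \<nu>)"
        by (simp add: davidson_def add_ac)
    qed
  qed
  then have "(\<exists>!\<theta>. is_arg_max (loglik_D3 n A) (\<lambda>\<theta>. \<theta> \<in> params_D3 n) \<theta>) \<longleftrightarrow>
      (\<exists>!\<theta>. is_arg_max (loglik n A) (\<lambda>\<theta>. \<theta> \<in> params n) \<theta>)"
    by (rule unique_arg_max_bij_betw[OF bij_betw_log_ratio[OF n]])
  then show ?thesis using unique_maximizer_iff[OF data n] by simp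
qed

section \<open>The characterization for both models\<close>

theorem theorem1:
  fixes n :: nat
    and F :: "real \<Rightarrow> real"
    and A :: "nat \<Rightarrow> nat \<Rightarrow> nat \<Rightarrow> nat"
  assumes "1 \<le> n"
    and "F \<in> class_F"
    and "data_matrix n A"
  shows "((\<exists>!\<theta>. is_arg_max (loglik_THMM3 F n A) (\<lambda>\<theta>. \<theta> \<in> params_THMM3 n) \<theta>)
            \<longleftrightarrow> A_NS n A \<and> B_NS n A \<and> C_NS n A)
       \<and> ((\<exists>!\<theta>. is_arg_max (loglik_D3 n A) (\<lambda>\<theta>. \<theta> \<in> params_D3 n) \<theta>)
            \<longleftrightarrow> A_NS n A \<and> B_NS n A \<and> C_NS n A)"
  using thurstone_unique_maximizer_iff[OF assms(2,3,1)] davidson_unique_maximizer_iff[OF assms(3,1)]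
  by (rule conjI)

end
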